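(* Let $G$ be a group given by a finite presentation $\langle S\mid r_1=r_1',\dots,r_n=r_n'\rangle$. Assume that the following hold: - For each $1\leq i\leq n$, the words $r_i,r_i'$ are positive words in $S$, without common (nonempty) prefix or suffix. - For each $1\leq i\leq n$, the word $r_i$ (and likewise $r_i'$) does not appear as a subword of any of the other $2n-1$ words among $r_1,r_1',\dots,r_n,r_n'$. - For each distinct $s,t\in S$, there exists at most one $1\leq i\leq n$ such that the first letters of $\{r_i,r_i'\}$ are $\{s,t\}$. - For each distinct $s,t\in S$, there exists at most one $1\leq i\leq n$ such that the last letters of $\{r_i,r_i'\}$ are $\{s,t\}$. - The presentation is $T(5)$, i.e. the link of the vertex in the presentation complex has girth at least $5$. Then $G\times\mathbb{Z}$ is a Garside group.
   Context: The presentation complex is the 2-dimensional cell complex with one vertex, one oriented edge loop for each $s\in S$, and for each relation $r_i=r_i'$ one 2-cell attached along the loop spelling $r_i(r_i')^{-1}$. The link of its vertex is the (not necessarily simplicial) graph with two vertices for each $s\in S$ (the outgoing and the incoming end of the loop $s$) and one edge for each corner of a 2-cell, joining the two ends of edges that meet at that corner. The girth of a (not necessarily simplicial) graph is the minimal number of edges in an embedded circle in the graph. A subword means a subword of consecutive letters. A group $G$ is a Garside group if there exist a finite subset $X\subset G$ and $\Delta\in G$ such that, denoting by $G^+$ the submonoid generated by $X$: (1) $X$ generates $G$; (2) for every $g\in G^+$ there is a bound on the length $n$ of expressions $g=x_1\cdots x_n$ with $x_i\in X\setminus\{1\}$; (3) the relations on $G^+$ given by $a\leq_L b$ iff $b\in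 aG^+$, and $a\leq_R b$ iff $b\in G^+a$, are lattice orders; (4) $\Delta\in G^+$ and $X=\{g\in G^+ : 1\leq_L g\leq_L\Delta\}=\{g\in G^+: 1\leq_R g\leq_R\Delta\}$. *)

theory Defs
  imports
    "HOL-Algebra.Elementary_Groups"
    "HOL-Algebra.Lattice"
    "HOL-Library.Extended_Nat"
    "HOL-Library.Sublist"
begin

section \<open>Group presentations with positive relations\<close>

datatype 'a letter = Gen 'a | Inv 'a

fun flip :: "'a letter \<Rightarrow> 'a letter" where
  "flip (Gen s) = Inv s"
| "flip (Inv s) = Gen s"

definition group_words :: "'a set \<Rightarrow> 'a letter list set" where
  "group_words S = lists (Gen ` S \<union> Inv ` S)"

definition inverse_word :: "'a letter list \<Rightarrow> 'a letter list" where
  "inverse_word w = rev (map flip w)"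

text \<open>
  A presentation is a set \<open>S\<close> of generators together with a list \<open>R\<close> of pairs of words in \<open>S\<close>,
  the pair \<open>(r, r')\<close> standing for the relation \<open>r = r'\<close>. A list is used, rather than a set, because
  relations are indexed (repetitions are relevant to the presentation complex).

  The group is the monoid of words in \<open>S \<union> S\<^sup>-\<^sup>1\<close> modulo the congruence generated by
  \<open>s s\<^sup>-\<^sup>1 = 1 = s\<^sup>-\<^sup>1 s\<close> and the relations in \<open>R\<close>; its elements are congruence classes.
\<close>

inductive_set pres_cong :: "'a set \<Rightarrow> ('a list \<times> 'a list) list \<Rightarrow> ('a letter list \<times> 'a letter list) set"
  for S :: "'a set" and R :: "('a list \<times> 'a list) list" where
  refl: "w \<in> group_words S \<Longrightarrow> (w, w) \<in> pres_cong S R"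
| sym: "(v, w) \<in> pres_cong S R \<Longrightarrow> (w, v) \<in> pres_cong S R"
| trans: "(u, v) \<in> pres_cong S R \<Longrightarrow> (v, w) \<in> pres_cong S R \<Longrightarrow> (u, w) \<in> pres_cong S R"
| cancel: "x \<in> Gen ` S \<union> Inv ` S \<Longrightarrow> u \<in> group_words S \<Longrightarrow> v \<in> group_words S \<Longrightarrow>
    (u @ [x, flip x] @ v, u @ v) \<in> pres_cong S R"
| rel: "(r, r') \<in> set R \<Longrightarrow> u \<in> group_words S \<Longrightarrow> v \<in> group_words S \<Longrightarrow>
    (u @ map Gen r @ v, u @ map Gen r' @ v) \<in> pres_cong S R"

definition presented_group :: "'a set \<Rightarrow> ('a list \<times> 'a list) list \<Rightarrow> 'a letter list set monoid" where
  "presented_group S R =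
    \<lparr>carrier = group_words S // pres_cong S R,
     monoid.mult = (\<lambda>A B. \<Union>a\<in>A. \<Union>b\<in>B. pres_cong S R `` {a @ b}),
     one = pres_cong S R `` {[]}\<rparr>"

lemma group_words_simps [simp]:
  "[] \<in> group_words S"
  "x # w \<in> group_words S \<longleftrightarrow> x \<in> Gen ` S \<union> Inv ` S \<and> w \<in> group_words S"
  "v @ w \<in> group_words S \<longleftrightarrow> v \<in> group_words S \<and> w \<in> group_words S"
  by (auto simp: group_words_def)

lemma map_Gen_in_group_words: "r \<in> lists S \<Longrightarrow> map Gen r \<in> group_words S"
  by (auto simp: group_words_def)

lemma inverse_word_in_group_words: "w \<in> group_words S \<Longrightarrow> inverse_word w \<in> group_words S"
  by (force simp: group_words_def inverse_word_def)

lemma pres_cong_subset: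
  assumes "set R \<subseteq> lists S \<times> lists S"
  shows "pres_cong S R \<subseteq> group_words S \<times> group_words S"
proof -
  have "v \<in> group_words S \<and> w \<in> group_words S" if "(v, w) \<in> pres_cong S R" for v w
    using that
  proof induction
    case (cancel x u v)
    then show ?case by (cases x) auto
  next
    case (rel r r' u v)
    then have "r \<in> lists S" "r' \<in> lists S" using assms by auto
    then show ?case using rel by (simp add: map_Gen_in_group_words)
  qed auto
  then show ?thesis by auto
qed

lemma equiv_pres_cong:
  assumes "set R \<subseteq> lists S \<times> lists S"
  shows "equiv (group_words S) (pres_cong S R)"
  using pres_cong_subset[OF assms]
  by (intro equivI refl_onI symI transI)
     (assumption | rule pres_cong.refl | erule pres_cong.sym | erule (1) pres_cong.trans)+

lemma pres_cong_context:
  assumes "(v, w) \<in> pres_cong S R" "x \<in> group_words S" "y \<in> group_words S"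
  shows "(x @ v @ y, x @ w @ y) \<in> pres_cong S R"
  using assms(1)
proof induction
  case (refl w)
  then show ?case using assms(2,3) by (simp add: pres_cong.refl)
next
  case (sym v w)
  then show ?case by (blast intro: pres_cong.sym)
next
  case (trans u v w)
  then show ?case by (blast intro: pres_cong.trans)
next
  case (cancel z u v)
  then show ?case using pres_cong.cancel[of z S "x @ u" "v @ y" R] assms(2,3) by simp
next
  case (rel r r' u v)
  then show ?case using pres_cong.rel[of r r' R "x @ u" S "v @ y"] assms(2,3) by simp
qed

lemma pres_cong_append:
  assumes R: "set R \<subseteq> lists S \<times> lists S"
    and "(v, v') \<in> pres_cong S R" "(w, w') \<in> pres_cong S R"
  shows "(v @ w, v' @ w') \<in> pres_cong S R"
proof -
  have *: "v' \<in> group_words S" "w \<in> group_words S"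
    using assms pres_cong_subset[OF R] by auto
  have "(v @ w, v' @ w) \<in> pres_cong S R"
    using pres_cong_context[OF assms(2), of "[]" w] * by simp
  moreover have "(v' @ w, v' @ w') \<in> pres_cong S R"
    using pres_cong_context[OF assms(3), of v' "[]"] * by simp
  ultimately show ?thesis by (rule pres_cong.trans)
qed

lemma pres_cong_inverse_word:
  assumes "w \<in> group_words S"
  shows "(inverse_word w @ w, []) \<in> pres_cong S R"
  using assms
proof (induction w)
  case Nil
  then show ?case by (simp add: inverse_word_def pres_cong.refl)
next
  case (Cons x w)
  then have "flip x \<in> Gen ` S \<union> Inv ` S" "flip (flip x) = x" by (cases x; auto)+
  then have "(inverse_word w @ [flip x, x] @ w, inverse_word w @ w) \<in> pres_cong S R"
    using Cons.prems pres_cong.cancel[of "flip x" S "inverse_word w" w R]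
    by (simp add: inverse_word_in_group_words)
  then have "(inverse_word w @ [flip x, x] @ w, []) \<in> pres_cong S R"
    by (rule pres_cong.trans) (use Cons in simp)
  then show ?case
    by (simp add: inverse_word_def)
qed

lemma presented_group_mult_class:
  assumes R: "set R \<subseteq> lists S \<times> lists S" and "v \<in> group_words S" "w \<in> group_words S"
  shows "mult (presented_group S R) (pres_cong S R `` {v}) (pres_cong S R `` {w}) =
    pres_cong S R `` {v @ w}"
proof -
  let ?c = "\<lambda>w. pres_cong S R `` {w}"
  have eq: "?c (a @ b) = ?c (v @ w)" if "a \<in> ?c v" "b \<in> ?c w" for a b
  proof -
    have "(v, a) \<in> pres_cong S R" "(w, b) \<in> pres_cong S R" using that by blast+
    from equiv_class_eq[OF equiv_pres_cong[OF R] pres_cong_append[OF R this]] show ?thesis by (rule HOL.sym)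
  qed
  have vw: "v \<in> ?c v" "w \<in> ?c w"
    using pres_cong.refl assms(2,3) by blast+
  have "(\<Union>a\<in>?c v. \<Union>b\<in>?c w. ?c (a @ b)) = (\<Union>a\<in>?c v. \<Union>b\<in>?c w. ?c (v @ w))"
    by (intro SUP_cong HOL.refl eq)
  also have "\<dots> = ?c (v @ w)" using vw by blast
  finally show ?thesis by (simp only: presented_group_def monoid.simps)
qed

theorem group_presented_group:
  assumes R: "set R \<subseteq> lists S \<times> lists S"
  shows "group (presented_group S R)"
proof -
  let ?G = "presented_group S R" and ?c = "\<lambda>w. pres_cong S R `` {w}"
  note mult = presented_group_mult_class[OF R]
  have carr: "carrier ?G = ?c ` group_words S" and one: "one ?G = ?c []"
    by (auto simp: presented_group_def quotient_def)
  show ?thesis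
  proof (rule groupI)
    fix x assume "x \<in> carrier ?G"
    then obtain w where w: "w \<in> group_words S" "x = ?c w" by (auto simp: carr)
    have "mult ?G (?c (inverse_word w)) x = ?c (inverse_word w @ w)"
      unfolding w(2) by (rule mult[OF inverse_word_in_group_words[OF w(1)] w(1)])
    also have "\<dots> = one ?G"
      unfolding one by (rule equiv_class_eq[OF equiv_pres_cong[OF R] pres_cong_inverse_word[OF w(1)]])
    finally show "\<exists>y\<in>carrier ?G. mult ?G y x = one ?G"
      unfolding carr by (rule bexI) (rule imageI[OF inverse_word_in_group_words[OF w(1)]])
  qed (auto simp: carr one mult intro!: imageI)
qed


section \<open>The link of the presentation complex\<close>

text \<open>Graphs may have loops and multiple edges; \<open>ends e\<close> is a singleton when \<open>e\<close> is a loop.\<close>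

record ('v, 'e) multigraph =
  verts :: "'v set"
  edges :: "'e set"
  ends :: "'e \<Rightarrow> 'v set"

text \<open>
  An embedded circle passes through pairwise distinct vertices \<open>vs ! 0, \<dots>, vs ! (k-1)\<close>, the
  pairwise distinct edges \<open>es ! j\<close> joining \<open>vs ! j\<close> to the cyclically next vertex. A loop is an
  embedded circle with \<open>k = 1\<close>, a pair of parallel edges one with \<open>k = 2\<close>.
\<close>

definition embedded_circle :: "('v, 'e) multigraph \<Rightarrow> 'v list \<Rightarrow> 'e list \<Rightarrow> bool" where
  "embedded_circle \<Gamma> vs es \<longleftrightarrow>
    es \<noteq> [] \<and> length vs = length es \<and> distinct vs \<and> distinct es \<and>
    set vs \<subseteq> verts \<Gamma> \<and> set es \<subseteq> edges \<Gamma> \<and>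
    (\<forall>j < length es. ends \<Gamma> (es ! j) = {vs ! j, vs ! (Suc j mod length es)})"

text \<open>The girth of a graph without embedded circles is \<open>\<infinity>\<close>, the infimum of the empty set.\<close>

definition girth :: "('v, 'e) multigraph \<Rightarrow> enat" where
  "girth \<Gamma> = Inf {enat (length es) |vs es. embedded_circle \<Gamma> vs es}"

datatype 'a link_vertex = Outgoing 'a | Incoming 'a

text \<open>
  A path running along an oriented edge loop leaves the vertex through the initial end and returns
  to it through the terminal end of the letter describing it.
\<close>

fun initial_end :: "'a letter \<Rightarrow> 'a link_vertex" where
  "initial_end (Gen s) = Outgoing s"
| "initial_end (Inv s) = Incoming s"

fun terminal_end :: "'a letter \<Rightarrow> 'a link_vertex" where
  "terminal_end (Gen s) = Incoming s"
| "terminal_end (Inv s) = Outgoing s"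

definition attaching_word :: "'a list \<times> 'a list \<Rightarrow> 'a letter list" where
  "attaching_word p = map Gen (fst p) @ inverse_word (map Gen (snd p))"

text \<open>
  The edge \<open>(i, j)\<close> of the link is the corner of the \<open>i\<close>-th 2-cell between the \<open>j\<close>-th and the
  cyclically next letter of its attaching word.
\<close>

definition presentation_link ::
  "'a set \<Rightarrow> ('a list \<times> 'a list) list \<Rightarrow> ('a link_vertex, nat \<times> nat) multigraph" where
  "presentation_link S R =
    \<lparr>verts = Outgoing ` S \<union> Incoming ` S,
     edges = {(i, j). i < length R \<and> j < length (attaching_word (R ! i))},
     ends = (\<lambda>(i, j). let w = attaching_word (R ! i) in
       {terminal_end (w ! j), initial_end (w ! (Suc j mod length w))})\<rparr>"


section \<open>Garside groups\<close>

definition generated_submonoid :: "('g, 'm) monoid_scheme \<Rightarrow> 'g set \<Rightarrow> 'g set" where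
  "generated_submonoid G X = \<Inter>{H. submonoid H G \<and> X \<subseteq> H}"

definition left_le :: "('g, 'm) monoid_scheme \<Rightarrow> 'g set \<Rightarrow> 'g \<Rightarrow> 'g \<Rightarrow> bool" where
  "left_le G P a b \<longleftrightarrow> b \<in> a <#\<^bsub>G\<^esub> P"

definition right_le :: "('g, 'm) monoid_scheme \<Rightarrow> 'g set \<Rightarrow> 'g \<Rightarrow> 'g \<Rightarrow> bool" where
  "right_le G P a b \<longleftrightarrow> b \<in> P #>\<^bsub>G\<^esub> a"

definition garside_structure :: "('g, 'm) monoid_scheme \<Rightarrow> 'g set \<Rightarrow> 'g \<Rightarrow> bool" where
  "garside_structure G X \<Delta> \<longleftrightarrow>
    (let P = generated_submonoid G X; L = left_le G P; R = right_le G P in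
      generate G X = carrier G \<and>
      (\<forall>g\<in>P. \<exists>N. \<forall>xs \<in> lists (X - {\<one>\<^bsub>G\<^esub>}). foldr (mult G) xs \<one>\<^bsub>G\<^esub> = g \<longrightarrow> length xs \<le> N) \<and>
      Lattice.lattice \<lparr>carrier = P, eq = (=), le = L\<rparr> \<and>
      Lattice.lattice \<lparr>carrier = P, eq = (=), le = R\<rparr> \<and>
      \<Delta> \<in> P \<and>
      X = {g \<in> P. L \<one>\<^bsub>G\<^esub> g \<and> L g \<Delta>} \<and>
      X = {g \<in> P. R \<one>\<^bsub>G\<^esub> g \<and> R g \<Delta>})"

definition garside_group :: "('g, 'm) monoid_scheme \<Rightarrow> bool" where
  "garside_group G \<longleftrightarrow> group G \<and>
    (\<exists>X \<Delta>. finite X \<and> X \<subseteq> carrier G \<and> \<Delta> \<in> carrier G \<and> garside_structure G X \<Delta>)"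

end

theory Submission
  imports Defs
begin

text \<open>
  The Garside element is the generator \<open>\<Delta> = (1, 1)\<close> of the central factor \<open>\<int>\<close>, and its divisors are the
  pairs \<open>(u, 0)\<close> and \<open>(u\<^sup>-\<^sup>1, 1)\<close> with \<open>u\<close> a subword of a relator. Taken abstractly, these divisors form
  a finite set with a partial product (a germ). The absence of circles of length at most 4 in the link
  makes the divisibility order of this germ free of bowties, hence a lattice.

  A finite associative cancellative germ with lattice order, all of whose elements divide a common \<open>\<Delta>\<close>
  with \<open>\<Delta>\<close> central, acts on sequences of its elements by passing a carry through greedy
  two-letter rewriting; the sequences reached from the constant sequence \<open>1\<close> are the greedy normal
  forms. Sending \<open>s\<close> to \<open>(s, 0)\<close> and \<open>s\<^sup>-\<^sup>1\<close> to \<open>\<Delta>\<^sup>-\<^sup>1 (s\<^sup>-\<^sup>1, 1)\<close> turns this into an invariant of \<open>G \<times> \<int>\<close>, so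
  positive elements have well-defined normal forms. The first entry of the normal form is the largest
  divisor of \<open>\<Delta>\<close> dividing the element; this gives least common multiples by tiling, and greatest
  common divisors because positive elements have finitely many divisors.
\<close>

section \<open>Germs and greedy normal forms\<close>

text \<open>The subwords of relators need not have a common multiple in \<open>G\<close>. Adjoining
  a central \<open>\<Delta>\<close> creates one: a subword \<open>u\<close> gets the complement
  \<open>u^-1 \<Delta>\<close>. The obstacle is that \<open>G\<close> is known only through its
  relations, so neither distinctness of germ elements in \<open>G\<close> nor the meaning of
  divisibility there is visible. The action on sequences settles both: it respects the relations, so
  equality in the group forces equality of normal forms. Only positive elements act, hence
  \<open>s^-1\<close> acts as \<open>s^-1 \<Delta>\<close>; the surplus powers of
  \<open>\<Delta>\<close> are counted and cancelled, \<open>\<Delta>\<close> acting injectively as a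
  shift. The link does not exclude every bowtie. Those made only of words, or only of complements,
  are excluded by the conditions on first and last letters; triangles and squares in the link
  exclude the mixed ones. Bigons show that a two-letter word occurs at only one place in the
  relators. The two sides of a relation are one element, so one side is kept as its name. The
  conditions on common prefixes and suffixes make the product cancellative; the subword condition
  makes it independent of that choice.\<close>

lemma finite_directed_max:
  assumes "finite D" "D \<noteq> {}"
    and "\<And>x y. x \<in> D \<Longrightarrow> y \<in> D \<Longrightarrow> \<exists>z\<in>D. rel x z \<and> rel y z"
    and "\<And>x y z. rel x y \<Longrightarrow> rel y z \<Longrightarrow> rel x z"
  shows "\<exists>m\<in>D. \<forall>x\<in>D. rel x m"
proof -
  have "finite F \<Longrightarrow> F \<subseteq> D \<Longrightarrow> \<exists>m\<in>D. \<forall>x\<in>F. rel x m" for F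
  proof (induction F rule: finite_induct)
    case empty
    then show ?case using assms(2) by auto
  next
    case (insert a F)
    then obtain m where "m \<in> D" "\<forall>x\<in>F. rel x m" by auto
    moreover obtain z where "z \<in> D" "rel m z" "rel a z"
      using insert.prems assms(3)[of m a] \<open>m \<in> D\<close> by auto
    ultimately show ?case using assms(4) by (intro bexI[of _ z]) auto
  qed
  then show ?thesis using assms(1) by blast
qed

text \<open>\<open>T x y z\<close> is the graph of a partial product \<open>x y = z\<close>.
  \<open>assoc1\<close> and \<open>assoc2\<close> say more than associativity: if one bracketing is
  defined, so is the other. \<open>bowtie\<close> asks for an interpolant between two lower and two
  upper elements; in a finite poset with least element \<open>e\<close> and greatest element
  \<open>d\<close> this yields all meets and joins.\<close>

locale germ =
  fixes X :: "'x set" and T :: "'x \<Rightarrow> 'x \<Rightarrow> 'x \<Rightarrow> bool" and e d :: 'x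
  assumes finite_X: "finite X"
    and T_closed: "T x y z \<Longrightarrow> x \<in> X \<and> y \<in> X \<and> z \<in> X"
    and T_fun: "T x y z \<Longrightarrow> T x y z' \<Longrightarrow> z = z'"
    and T_cancel: "T x y z \<Longrightarrow> T x y' z \<Longrightarrow> y = y'"
    and e_in: "e \<in> X"
    and T_e_left: "x \<in> X \<Longrightarrow> T e x x"
    and T_e_right: "x \<in> X \<Longrightarrow> T x e x"
    and assoc1: "T x y p \<Longrightarrow> T p z q \<Longrightarrow> \<exists>r. T y z r \<and> T x r q"
    and assoc2: "T y z r \<Longrightarrow> T x r q \<Longrightarrow> \<exists>p. T x y p \<and> T p z q"
    and conical: "T x y e \<Longrightarrow> x = e"
    and complement: "x \<in> X \<Longrightarrow> \<exists>y. T x y d \<and> T y x d"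
    and bowtie: "T p a x \<Longrightarrow> T q b x \<Longrightarrow> T p a' y \<Longrightarrow> T q b' y \<Longrightarrow>
      \<exists>t. (\<exists>c. T p c t) \<and> (\<exists>c. T q c t) \<and> (\<exists>c. T t c x) \<and> (\<exists>c. T t c y)"
begin

section \<open>Divisibility order of a germ and greedy two-letter rewriting\<close>

definition leq :: "'x \<Rightarrow> 'x \<Rightarrow> bool" where
  "leq x z \<longleftrightarrow> (\<exists>y. T x y z)"

lemma d_in: "d \<in> X"
  using complement[OF e_in] T_closed by blast

lemma leq_in: "leq x y \<Longrightarrow> x \<in> X \<and> y \<in> X"
  using T_closed leq_def by blast

lemma leq_trans: "leq x y \<Longrightarrow> leq y z \<Longrightarrow> leq x z"
  unfolding leq_def using assoc1 by blast

lemma leq_d: "x \<in> X \<Longrightarrow> leq x d"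
  using complement leq_def by blast

lemma e_leq: "x \<in> X \<Longrightarrow> leq e x"
  using T_e_left leq_def by blast

lemma leq_e: "leq x e \<Longrightarrow> x = e"
  using conical leq_def by blast

lemma leq_antisym: "leq x y \<Longrightarrow> leq y x \<Longrightarrow> x = y"
proof -
  assume "leq x y" "leq y x"
  then obtain a b where ab: "T x a y" "T y b x" unfolding leq_def by blast
  then obtain r where r: "T a b r" "T x r x" using assoc1 by blast
  have "r = e" using r(2) T_e_right T_closed T_cancel by blast
  then have "a = e" using r(1) conical by blast
  then show "x = y" using ab(1) T_e_right T_closed T_fun by blast
qed

lemma leq_bowtie:
  "leq p x \<Longrightarrow> leq q x \<Longrightarrow> leq p y \<Longrightarrow> leq q y \<Longrightarrow>
    \<exists>t. leq p t \<and> leq q t \<and> leq t x \<and> leq t y"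
  unfolding leq_def using bowtie by metis

text \<open>The common lower bounds form a finite set, directed by \<open>leq_bowtie\<close>, so
  they have a largest member. The same argument with the order reversed gives joins.\<close>

lemma meet_exists:
  assumes "x \<in> X" "y \<in> X"
  shows "\<exists>m. leq m x \<and> leq m y \<and> (\<forall>z. leq z x \<longrightarrow> leq z y \<longrightarrow> leq z m)"
proof -
  have "\<exists>m\<in>{z. leq z x \<and> leq z y}. \<forall>z\<in>{z. leq z x \<and> leq z y}. leq z m"
  proof (rule finite_directed_max)
    show "finite {z. leq z x \<and> leq z y}"
      by (rule finite_subset[OF _ finite_X]) (use leq_in in blast)
    show "{z. leq z x \<and> leq z y} \<noteq> {}" using e_leq assms by blast
    show "\<exists>t\<in>{z. leq z x \<and> leq z y}. leq p t \<and> leq q t"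
      if "p \<in> {z. leq z x \<and> leq z y}" "q \<in> {z. leq z x \<and> leq z y}" for p q
      using that leq_bowtie[of p x q y] by blast
  qed (rule leq_trans)
  then show ?thesis by blast
qed

lemma join_exists:
  assumes "x \<in> X" "y \<in> X"
  shows "\<exists>m. leq x m \<and> leq y m \<and> (\<forall>z. leq x z \<longrightarrow> leq y z \<longrightarrow> leq m z)"
proof -
  have "\<exists>m\<in>{z. leq x z \<and> leq y z}. \<forall>z\<in>{z. leq x z \<and> leq y z}. leq m z"
  proof (rule finite_directed_max)
    show "finite {z. leq x z \<and> leq y z}"
      by (rule finite_subset[OF _ finite_X]) (use leq_in in blast)
    show "{z. leq x z \<and> leq y z} \<noteq> {}" using leq_d assms by blast
    show "\<exists>t\<in>{z. leq x z \<and> leq y z}. leq t p \<and> leq t q"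
      if "p \<in> {z. leq x z \<and> leq y z}" "q \<in> {z. leq x z \<and> leq y z}" for p q
      using that leq_bowtie[of x p y q] by blast
  qed (rule leq_trans)
  then show ?thesis by blast
qed

text \<open>Pulling the largest possible piece \<open>a\<close> of \<open>x = a r\<close> into \<open>c\<close> turns \<open>c | x\<close> into
  the greedy pair \<open>o | r\<close> with \<open>o = c a\<close>.\<close>

definition domino :: "'x \<Rightarrow> 'x \<Rightarrow> 'x \<Rightarrow> 'x \<Rightarrow> 'x \<Rightarrow> bool" where
  "domino c x a o' r \<longleftrightarrow> T c a o' \<and> T a r x \<and> (\<forall>z w. leq z x \<longrightarrow> T c z w \<longrightarrow> leq z a)"

text \<open>With \<open>s\<close> the complement of \<open>c\<close>, the elements that can be
  multiplied onto \<open>c\<close> are exactly the divisors of \<open>s\<close>. The piece to pull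
  out of \<open>x\<close> is therefore the meet of \<open>x\<close> and \<open>s\<close>.\<close>

lemma domino_exists:
  assumes "c \<in> X" "x \<in> X"
  shows "\<exists>a o' r. domino c x a o' r"
proof -
  obtain s where s: "T c s d" using complement assms by blast
  then obtain a where a: "leq a x" "leq a s" "\<And>z. leq z x \<Longrightarrow> leq z s \<Longrightarrow> leq z a"
    using meet_exists assms T_closed by meson
  obtain b r where br: "T a b s" "T a r x" using a leq_def by blast
  obtain p where p: "T c a p" using assoc2[OF br(1) s] by blast
  have "leq z a" if zx: "leq z x" and zw: "T c z w" for z w
  proof -
    obtain v where "T w v d" using complement zw T_closed by blast
    with zw obtain u where "T z v u" "T c u d" using assoc1 by blast
    then have "leq z s" using s T_cancel leq_def by blast
    then show ?thesis using a zx by blast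
  qed
  then show ?thesis using p br domino_def by blast
qed

lemma domino_unique:
  assumes "domino c x a o' r" "domino c x a1 o1 r1"
  shows "a = a1 \<and> o' = o1 \<and> r = r1"
proof -
  have "leq a x" "leq a1 x" using assms unfolding domino_def leq_def by blast+
  then have "leq a a1" "leq a1 a" using assms unfolding domino_def by blast+
  then have "a = a1" by (rule leq_antisym)
  then show ?thesis using assms T_fun T_cancel unfolding domino_def by blast
qed

definition head :: "'x \<Rightarrow> 'x \<Rightarrow> 'x" where
  "head c x = (SOME o'. \<exists>a r. domino c x a o' r)"

definition rem :: "'x \<Rightarrow> 'x \<Rightarrow> 'x" where
  "rem c x = (SOME r. \<exists>a o'. domino c x a o' r)"

lemma head_eq: "domino c x a o' r \<Longrightarrow> head c x = o'"
  unfolding head_def by (rule some_equality) (use domino_unique in blast)+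

lemma rem_eq: "domino c x a o' r \<Longrightarrow> rem c x = r"
  unfolding rem_def by (rule some_equality) (use domino_unique in blast)+

lemma domino_head_rem:
  assumes "c \<in> X" "x \<in> X"
  obtains a where "domino c x a (head c x) (rem c x)"
  using domino_exists[OF assms] head_eq rem_eq by metis

lemma domino_in: "domino c x a o' r \<Longrightarrow> a \<in> X \<and> o' \<in> X \<and> r \<in> X"
  unfolding domino_def using T_closed by blast

lemma head_in: "c \<in> X \<Longrightarrow> x \<in> X \<Longrightarrow> head c x \<in> X"
  and rem_in: "c \<in> X \<Longrightarrow> x \<in> X \<Longrightarrow> rem c x \<in> X"
  by (metis domino_head_rem domino_in)+

lemma leq_head: "c \<in> X \<Longrightarrow> x \<in> X \<Longrightarrow> leq c (head c x)"
  by (metis domino_head_rem domino_def leq_def)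

text \<open>Dominoes stack: feeding \<open>x\<close> first to \<open>z\<close> and then the outcome
  to \<open>y\<close> has the same output as feeding \<open>x\<close> to \<open>p = y z\<close>, and
  the remainders multiply. This is what makes the rewriting an action.\<close>

lemma domino_compose:
  assumes yz: "T y z p" and 1: "domino z x a o1 r" and 2: "domino y o1 a' o2 r'"
  shows "\<exists>a'' r''. domino p x a'' o2 r'' \<and> T r' r r''"
proof -
  note D1 = 1[unfolded domino_def] and D2 = 2[unfolded domino_def]
  \<comment> \<open>\<open>z\<close> divides \<open>o1\<close>, and \<open>y z\<close> is defined,
    so the maximal piece \<open>a'\<close> contains \<open>z\<close>.\<close>
  have "leq z a'" using D1 D2 yz leq_def by blast
  then obtain a'' where a'': "T z a'' a'" using leq_def by blast
  obtain a1 where a1: "T a'' r' a1" "T z a1 o1" using assoc1 a'' D2 by blast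
  then have "a1 = a" using D1 T_cancel by blast
  then obtain r'' where r'': "T r' r r''" "T a'' r'' x" using a1 assoc1 D1 by blast
  have o2: "T p a'' o2" using assoc2[OF a'', of y o2] D2 yz T_fun by blast
  have "leq w a''" if w: "leq w x" "T p w q" for w q
  proof -
    obtain t where t: "T z w t" "T y t q" using assoc1[OF yz w(2)] by blast
    then have "leq w a" using D1 w by blast
    then obtain b where "T w b a" using leq_def by blast
    then have "leq t o1" using D1 t(1) assoc2[of w b a z o1] T_fun leq_def by blast
    then obtain u where "T t u a'" using D2 t(2) leq_def by blast
    then obtain u' where "T w u u'" "T z u' a'" using assoc1 t(1) by blast
    then show ?thesis using a'' T_cancel leq_def by blast
  qed
  then show ?thesis using o2 r'' unfolding domino_def by blast
qed

lemma head_rem_compose: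
  assumes "T y z p" "x \<in> X"
  shows "head p x = head y (head z x)" "T (rem y (head z x)) (rem z x) (rem p x)"
proof -
  have in_X: "y \<in> X" "z \<in> X" "p \<in> X" using T_closed assms by auto
  obtain a where 1: "domino z x a (head z x) (rem z x)" using domino_head_rem in_X assms by metis
  obtain a' where 2: "domino y (head z x) a' (head y (head z x)) (rem y (head z x))"
    using domino_head_rem in_X assms head_in by metis
  obtain a'' r'' where "domino p x a'' (head y (head z x)) r''" "T (rem y (head z x)) (rem z x) r''"
    using domino_compose[OF assms(1) 1 2] by blast
  then show "head p x = head y (head z x)" "T (rem y (head z x)) (rem z x) (rem p x)"
    using head_eq rem_eq by metis+
qed

lemma domino_e_left: "x \<in> X \<Longrightarrow> domino e x x x e"
  unfolding domino_def using T_e_left T_e_right by blast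

lemma domino_e_right: "c \<in> X \<Longrightarrow> domino c e e c e"
  unfolding domino_def using T_e_right e_in leq_e e_leq by blast

section \<open>Action of the germ on sequences\<close>

text \<open>The remainder of each domino becomes the left factor of the next one:
  \<open>carry y f n\<close> is what arrives at position \<open>n\<close> when \<open>y\<close> is
  multiplied onto \<open>f\<close> from the left. Infinite sequences ending in \<open>e\<close>
  avoid any bookkeeping of lengths.\<close>

primrec carry :: "'x \<Rightarrow> (nat \<Rightarrow> 'x) \<Rightarrow> nat \<Rightarrow> 'x" where
  "carry y f 0 = y"
| "carry y f (Suc n) = rem (carry y f n) (f n)"

definition act :: "'x \<Rightarrow> (nat \<Rightarrow> 'x) \<Rightarrow> nat \<Rightarrow> 'x" where
  "act y f n = head (carry y f n) (f n)"

text \<open>Greediness is local: no nontrivial piece of an entry can be moved into the entry before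
  it.\<close>

definition normal :: "(nat \<Rightarrow> 'x) \<Rightarrow> bool" where
  "normal f \<longleftrightarrow> range f \<subseteq> X \<and> (\<forall>n. head (f n) (f (Suc n)) = f n)"

lemma normal_in: "normal f \<Longrightarrow> f n \<in> X"
  unfolding normal_def by blast

lemma carry_in: "y \<in> X \<Longrightarrow> range f \<subseteq> X \<Longrightarrow> carry y f n \<in> X"
  by (induction n) (auto intro: rem_in)

lemma act_in: "y \<in> X \<Longrightarrow> range f \<subseteq> X \<Longrightarrow> act y f n \<in> X"
  unfolding act_def by (intro head_in carry_in) auto

text \<open>The invariant behind \<open>act_mult\<close>: at every position the carry of a product
  is the product of the carries, by stacking dominoes.\<close>

lemma carry_mult:
  assumes "T y z p" "range f \<subseteq> X"
  shows "T (carry y (act z f) n) (carry z f n) (carry p f n)"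
proof (induction n)
  case (Suc n)
  have "f n \<in> X" using assms by blast
  from head_rem_compose(2)[OF Suc this] show ?case by (simp add: act_def)
qed (use assms in simp)

lemma act_mult:
  assumes "T y z p" "range f \<subseteq> X"
  shows "act y (act z f) = act p f"
proof
  fix n
  have "f n \<in> X" using assms by blast
  from head_rem_compose(1)[OF carry_mult[OF assms] this]
  show "act y (act z f) n = act p f n" by (simp add: act_def)
qed

lemma head_e_left: "x \<in> X \<Longrightarrow> head e x = x"
  and rem_e_left: "x \<in> X \<Longrightarrow> rem e x = e"
  and head_e_right: "x \<in> X \<Longrightarrow> head x e = x"
  and rem_e_right: "x \<in> X \<Longrightarrow> rem x e = e"
  using domino_e_left domino_e_right head_eq rem_eq by blast+

lemma act_e:
  assumes "range f \<subseteq> X"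
  shows "act e f = f"
proof
  fix n
  have "f k \<in> X" for k using assms by blast
  moreover from this have "carry e f n = e" by (induction n) (auto simp: rem_e_left)
  ultimately show "act e f n = f n" by (simp add: act_def head_e_left)
qed

lemma head_fixedD:
  assumes "head x y = x" "x \<in> X" "y \<in> X" "T x z w" "leq z y"
  shows "z = e"
proof -
  obtain a where a: "domino x y a x (rem x y)" using domino_head_rem assms by metis
  then have "a = e" using T_e_right T_cancel assms(2) unfolding domino_def by blast
  then show ?thesis using a assms(4,5) leq_e unfolding domino_def by blast
qed

lemma domino_fixedI:
  assumes "x \<in> X" "y \<in> X" "\<And>z w. T x z w \<Longrightarrow> leq z y \<Longrightarrow> z = e"
  shows "domino x y e x y"
  unfolding domino_def using assms T_e_left T_e_right e_leq e_in by blast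

text \<open>A piece that could move from the new entry \<open>n + 1\<close> into the new entry
  \<open>n\<close> could already have been pulled out of \<open>f n\<close> by the carry, against
  the maximality of what was pulled.\<close>

lemma normal_act:
  assumes "y \<in> X" "normal f"
  shows "normal (act y f)"
proof -
  have f: "range f \<subseteq> X" using assms normal_def by blast
  have "head (act y f n) (act y f (Suc n)) = act y f n" for n
  proof -
    define c where "c = carry y f n"
    define c' where "c' = rem c (f n)"
    have c: "c \<in> X" "f n \<in> X" "f (Suc n) \<in> X" using carry_in[OF assms(1) f] f c_def by auto
    obtain a where a: "domino c (f n) a (act y f n) c'"
      using domino_head_rem[of c "f n"] c unfolding act_def c_def[symmetric] c'_def by metis
    have "c' \<in> X" using c rem_in c'_def by simp
    then have o': "act y f (Suc n) = head c' (f (Suc n))"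
      by (simp add: act_def c_def c'_def)
    \<comment> \<open>As \<open>f n\<close> factors as \<open>a\<close> times \<open>c'\<close>,
      normality of \<open>f\<close> at \<open>n\<close> becomes a statement about \<open>a\<close>
      and the next carry \<open>c'\<close>.\<close>
    have comp: "head (f n) (f (Suc n)) = head a (head c' (f (Suc n)))"
      using head_rem_compose(1)[of a c' "f n" "f (Suc n)"] a c unfolding domino_def by blast
    have "z = e" if z: "T (act y f n) z w" "leq z (act y f (Suc n))" for z w
    proof -
      obtain b where b: "T a z b" "T c b w" using a z(1) assoc1 unfolding domino_def by blast
      obtain a2 where a2: "domino a (head c' (f (Suc n))) a2 (f n) (rem a (head c' (f (Suc n))))"
        using domino_head_rem[of a "head c' (f (Suc n))"] comp assms(2) c \<open>c' \<in> X\<close> head_in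
          domino_in[OF a] unfolding normal_def by metis
      then have "leq z a2" using z b o' unfolding domino_def by metis
      then obtain t where "T z t a2" using leq_def by blast
      \<comment> \<open>\<open>b = a z\<close> still divides \<open>f n\<close>, and
        \<open>c b\<close> is defined; maximality of \<open>a\<close> then leaves no room for
        \<open>z\<close>.\<close>
      then have "leq b (f n)" using a2 b(1) assoc2 T_fun unfolding domino_def leq_def by metis
      then have "leq b a" using a b(2) unfolding domino_def by blast
      moreover have "leq a b" using b(1) leq_def by blast
      ultimately have "b = a" by (rule leq_antisym)
      then show "z = e" using b(1) T_e_right T_cancel T_closed by blast
    qed
    then have "domino (act y f n) (act y f (Suc n)) e (act y f n) (act y f (Suc n))"
      using act_in[OF assms(1) f] by (intro domino_fixedI) auto
    then show ?thesis by (rule head_eq)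
  qed
  moreover have "range (act y f) \<subseteq> X" using act_in[OF assms(1) f] by auto
  ultimately show ?thesis unfolding normal_def by blast
qed

lemma domino_d: "x \<in> X \<Longrightarrow> domino d x e d x"
proof (rule domino_fixedI)
  fix z w assume "T d z w"
  moreover from this obtain v where "T w v d" using complement T_closed by blast
  ultimately obtain u where "T z v u" "T d u d" using assoc1 by blast
  then have "u = e" using T_e_right d_in T_cancel by blast
  then show "z = e" using \<open>T z v u\<close> conical by blast
qed (use d_in in auto)

lemma rem_fixed: "x \<in> X \<Longrightarrow> y \<in> X \<Longrightarrow> head x y = x \<Longrightarrow> rem x y = y"
  using domino_fixedI[of x y] head_fixedD rem_eq by blast

text \<open>Nothing nontrivial can be multiplied onto \<open>d\<close>, so \<open>d\<close> stays in
  front and the carry pushes every entry one place to the right. Hence \<open>d\<close> acts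
  injectively.\<close>

lemma act_d:
  assumes "normal f"
  shows "act d f 0 = d" "act d f (Suc n) = f n"
proof -
  note f = normal_in[OF assms]
  have c: "carry d f (Suc n) = f n" for n
  proof (induction n)
    case 0
    show ?case using rem_eq[OF domino_d[OF f]] by simp
  next
    case (Suc n)
    then show ?case using rem_fixed f assms by (simp add: normal_def)
  qed
  show "act d f 0 = d" using head_eq[OF domino_d[OF f]] by (simp add: act_def)
  show "act d f (Suc n) = f n" unfolding act_def c using assms by (simp add: normal_def)
qed

lemma act_d_inj: "normal f \<Longrightarrow> normal g \<Longrightarrow> act d f = act d g \<Longrightarrow> f = g"
  by (metis act_d(2) ext)

text \<open>With \<open>x y = d = y x\<close>, both sides are the action of \<open>x\<close>, then
  \<open>y\<close>, then \<open>x\<close>.\<close>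

lemma act_d_commute:
  assumes "x \<in> X" "normal f"
  shows "act x (act d f) = act d (act x f)"
proof -
  obtain y where "T x y d" "T y x d" using complement assms by blast
  moreover have "range f \<subseteq> X" "range (act x f) \<subseteq> X"
    using assms act_in normal_def by blast+
  ultimately show ?thesis using act_mult by metis
qed

section \<open>Normal forms and their length\<close>

definition unit_seq :: "nat \<Rightarrow> 'x" where
  "unit_seq n = e"

lemma normal_unit_seq: "normal unit_seq"
  using e_in head_e_left by (auto simp: normal_def unit_seq_def)

definition nf :: "'x list \<Rightarrow> nat \<Rightarrow> 'x" where
  "nf xs = foldr act xs unit_seq"

lemma nf_simps [simp]: "nf [] = unit_seq" "nf (x # xs) = act x (nf xs)"
  by (simp_all add: nf_def)

lemma normal_nf: "xs \<in> lists X \<Longrightarrow> normal (nf xs)"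
  by (induction xs) (auto simp: normal_unit_seq intro: normal_act)

definition supp_le :: "nat \<Rightarrow> (nat \<Rightarrow> 'x) \<Rightarrow> bool" where
  "supp_le K f \<longleftrightarrow> (\<forall>n\<ge>K. f n = e)"

lemma carry_supp:
  assumes "y \<in> X" "normal f" "supp_le K f" "n > K"
  shows "carry y f n = e"
proof -
  obtain m where m: "n = Suc m" "m \<ge> K" using assms(4) by (cases n) auto
  have "carry y f m \<in> X" using assms normal_def carry_in by blast
  then show ?thesis using m assms(3) rem_e_right by (simp add: supp_le_def)
qed

lemma supp_le_act:
  assumes "y \<in> X" "normal f" "supp_le K f"
  shows "supp_le (Suc K) (act y f)"
  using carry_supp[OF assms] assms(3) e_in head_e_left
  by (auto simp: supp_le_def act_def)

lemma supp_le_nf: "xs \<in> lists X \<Longrightarrow> \<exists>K. supp_le K (nf xs)"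
proof (induction xs)
  case Nil
  then show ?case by (auto simp: supp_le_def unit_seq_def)
next
  case (Cons x xs)
  then show ?case using supp_le_act normal_nf by (metis lists.simps list.inject list.distinct(1) nf_simps(2))
qed

text \<open>Multiplying from the left never shortens: the carry divides the new entry, so where the
  new entry is \<open>e\<close> the carry and the old entry are \<open>e\<close> too. This bounds
  the length of right divisors.\<close>

lemma supp_le_actD:
  assumes "y \<in> X" "normal f" "supp_le K (act y f)"
  shows "supp_le K f"
  unfolding supp_le_def
proof (intro allI impI)
  fix n assume "n \<ge> K"
  have f: "f n \<in> X" using assms normal_in by blast
  have c: "carry y f n \<in> X" using assms normal_def carry_in by blast
  have "act y f n = e" using assms(3) \<open>n \<ge> K\<close> by (simp add: supp_le_def)
  then have h: "head (carry y f n) (f n) = e" by (simp add: act_def)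
  then have "carry y f n = e" using leq_head[OF c f] leq_e by simp
  then show "f n = e" using h head_e_left[OF f] by simp
qed

lemma act_unit_seq:
  assumes "y \<in> X"
  shows "act y unit_seq 0 = y" "act y unit_seq (Suc n) = e"
proof -
  show "act y unit_seq 0 = y" using head_e_right assms by (simp add: act_def unit_seq_def)
  have "supp_le (Suc 0) (act y unit_seq)"
    using supp_le_act[OF assms normal_unit_seq, of 0] by (simp add: supp_le_def unit_seq_def)
  then show "act y unit_seq (Suc n) = e" by (simp add: supp_le_def)
qed

lemma leq_act:
  assumes "y \<in> X" "normal f"
  shows "leq y (act y f 0)"
  using leq_head[of y "f 0"] assms normal_in by (simp add: act_def)

lemma act_eq_unit_seqD:
  assumes "y \<in> X" "normal f" "act y f = unit_seq"
  shows "y = e" "f = unit_seq"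
proof -
  show "y = e" using leq_act[OF assms(1,2)] leq_e assms(3) by (simp add: unit_seq_def)
  then show "f = unit_seq" using assms act_e normal_def by metis
qed

lemma nf_eq_unit_seqD: "xs \<in> lists X \<Longrightarrow> nf xs = unit_seq \<Longrightarrow> set xs \<subseteq> {e}"
proof (induction xs)
  case (Cons x xs)
  then show ?case using act_eq_unit_seqD[of x "nf xs"] normal_nf[of xs] by auto
qed simp

text \<open>The second entry \<open>e\<close> forces the remainder of the first domino to be
  \<open>e\<close>, so \<open>x\<close> has absorbed all of \<open>f 0\<close>. Thus a factorisation
  of \<open>d\<close> in the group is already visible in the germ.\<close>

lemma act_eq_d:
  assumes "x \<in> X" "normal f" "act x f = act d unit_seq"
  shows "T x (f 0) d"
proof -
  have f0: "f 0 \<in> X" using assms normal_in by blast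
  obtain a where a: "domino x (f 0) a (head x (f 0)) (rem x (f 0))" using domino_head_rem assms(1) f0 by metis
  have h: "head x (f 0) = d" using fun_cong[OF assms(3), of 0] act_unit_seq d_in by (simp add: act_def)
  have f1: "f 1 \<in> X" using assms normal_in by blast
  have c: "rem x (f 0) \<in> X" using rem_in f0 assms by simp
  have "head (rem x (f 0)) (f 1) = e"
    using fun_cong[OF assms(3), of 1] act_unit_seq(2)[OF d_in, of 0] by (simp add: act_def)
  then have "rem x (f 0) = e" using leq_head[OF c f1] leq_e by simp
  then have "a = f 0" using a T_fun T_e_right T_closed unfolding domino_def by metis
  then show ?thesis using a h unfolding domino_def by metis
qed

end

section \<open>Garside groups from germs\<close>

lemma latticeI:
  assumes "\<And>x. x \<in> P \<Longrightarrow> r x x"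
    and "\<And>x y. x \<in> P \<Longrightarrow> y \<in> P \<Longrightarrow> r x y \<Longrightarrow> r y x \<Longrightarrow> x = y"
    and "\<And>x y z. x \<in> P \<Longrightarrow> y \<in> P \<Longrightarrow> z \<in> P \<Longrightarrow> r x y \<Longrightarrow> r y z \<Longrightarrow> r x z"
    and join: "\<And>x y. x \<in> P \<Longrightarrow> y \<in> P \<Longrightarrow>
      \<exists>s\<in>P. r x s \<and> r y s \<and> (\<forall>z\<in>P. r x z \<longrightarrow> r y z \<longrightarrow> r s z)"
    and meet: "\<And>x y. x \<in> P \<Longrightarrow> y \<in> P \<Longrightarrow>
      \<exists>s\<in>P. r s x \<and> r s y \<and> (\<forall>z\<in>P. r z x \<longrightarrow> r z y \<longrightarrow> r z s)"
  shows "Lattice.lattice \<lparr>carrier = P, eq = (=), le = r\<rparr>"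
proof -
  interpret partial_order "\<lparr>carrier = P, eq = (=), le = r\<rparr>"
    by unfold_locales (simp_all add: assms(1), metis assms(2), metis assms(3))
  show ?thesis
  proof
    fix x y assume "x \<in> carrier \<lparr>carrier = P, eq = (=), le = r\<rparr>" "y \<in> carrier \<lparr>carrier = P, eq = (=), le = r\<rparr>"
    then have xy: "x \<in> P" "y \<in> P" by auto
    from join[OF xy] obtain s where "s \<in> P" "r x s" "r y s" "\<forall>z\<in>P. r x z \<longrightarrow> r y z \<longrightarrow> r s z" by blast
    then show "\<exists>s. is_lub \<lparr>carrier = P, eq = (=), le = r\<rparr> s {x, y}"
      using xy by (intro exI[of _ s]) (auto simp: least_def Upper_def)
    from meet[OF xy] obtain s where "s \<in> P" "r s x" "r s y" "\<forall>z\<in>P. r z x \<longrightarrow> r z y \<longrightarrow> r z s" by blast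
    then show "\<exists>s. is_glb \<lparr>carrier = P, eq = (=), le = r\<rparr> s {x, y}"
      using xy by (intro exI[of _ s]) (auto simp: greatest_def Lower_def)
  qed
qed

text \<open>\<open>emb_faithful\<close> carries the weight: equal products in \<open>H\<close> must
  have equal normal forms. The converse direction, that a normal form multiplies back to its
  element, is derived in \<open>pr_nf\<close>.\<close>

locale garside_rep = germ X T e d + group H
  for X :: "'x set" and T e d and H (structure) +
  fixes emb :: "'x \<Rightarrow> 'g"
  assumes emb_closed: "x \<in> X \<Longrightarrow> emb x \<in> carrier H"
    and emb_mult: "T x y z \<Longrightarrow> emb x \<otimes> emb y = emb z"
    and emb_generate: "generate H (emb ` X) = carrier H"
    and emb_faithful: "xs \<in> lists X \<Longrightarrow> ys \<in> lists X \<Longrightarrow>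
      foldr (\<lambda>x. (\<otimes>) (emb x)) xs \<one> = foldr (\<lambda>x. (\<otimes>) (emb x)) ys \<one> \<Longrightarrow> nf xs = nf ys"
begin

section \<open>The positive monoid and its divisibility order\<close>

lemma inv_mult_cancel:
  assumes "a \<in> carrier H" "b \<in> carrier H"
  shows "inv a \<otimes> (a \<otimes> b) = b" "a \<otimes> (inv a \<otimes> b) = b"
  using assms by (simp_all add: m_assoc[symmetric])

definition pr :: "'x list \<Rightarrow> 'g" where
  "pr xs = foldr (\<lambda>x. (\<otimes>) (emb x)) xs \<one>"

definition P :: "'g set" where
  "P = pr ` lists X"

text \<open>Relates arbitrary elements of \<open>H\<close>, not only those of \<open>P\<close>: the
  quotient \<open>inv a \<otimes> b\<close> is to be positive. The larger domain is what lets
  inversion carry the left order to the right one.\<close>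

definition pre :: "'g \<Rightarrow> 'g \<Rightarrow> bool" where
  "pre a b \<longleftrightarrow> (\<exists>p\<in>P. b = a \<otimes> p)"

lemma pr_simps [simp]: "pr [] = \<one>" "pr (x # xs) = emb x \<otimes> pr xs"
  by (simp_all add: pr_def)

lemma pr_closed: "xs \<in> lists X \<Longrightarrow> pr xs \<in> carrier H"
  by (induction xs) (auto intro: emb_closed)

lemma pr_append: "xs \<in> lists X \<Longrightarrow> ys \<in> lists X \<Longrightarrow> pr (xs @ ys) = pr xs \<otimes> pr ys"
proof (induction xs)
  case Nil
  then show ?case by (simp add: pr_closed)
next
  case (Cons x xs)
  then have "x \<in> X" "xs \<in> lists X" by auto
  then show ?case using Cons by (simp add: m_assoc emb_closed pr_closed)
qed

lemma nf_eqI: "xs \<in> lists X \<Longrightarrow> ys \<in> lists X \<Longrightarrow> pr xs = pr ys \<Longrightarrow> nf xs = nf ys"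
  unfolding pr_def by (rule emb_faithful)

lemma P_cases: "p \<in> P \<Longrightarrow> (\<And>xs. xs \<in> lists X \<Longrightarrow> p = pr xs \<Longrightarrow> thesis) \<Longrightarrow> thesis"
  unfolding P_def by blast

lemma P_closed: "p \<in> P \<Longrightarrow> p \<in> carrier H"
  unfolding P_def using pr_closed by blast

lemma pr_in_P: "xs \<in> lists X \<Longrightarrow> pr xs \<in> P"
  unfolding P_def by blast

lemma P_one: "\<one> \<in> P"
  using pr_in_P[of "[]"] by simp

lemma P_mult: "p \<in> P \<Longrightarrow> q \<in> P \<Longrightarrow> p \<otimes> q \<in> P"
  by (elim P_cases) (metis pr_append pr_in_P append_in_lists_conv)

lemma emb_in_P: "x \<in> X \<Longrightarrow> emb x \<in> P"
  using pr_in_P[of "[x]"] emb_closed by simp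

lemma emb_e: "emb e = \<one>"
  using emb_mult[OF T_e_left[OF e_in]] emb_closed[OF e_in] by simp

lemma generated_submonoid_P: "generated_submonoid H (emb ` X) = P"
proof
  have "submonoid P H"
    by unfold_locales (use P_closed P_one P_mult in auto)
  then show "generated_submonoid H (emb ` X) \<subseteq> P"
    unfolding generated_submonoid_def using emb_in_P by blast
  have "pr xs \<in> K" if "submonoid K H" "emb ` X \<subseteq> K" "xs \<in> lists X" for K xs
    using that(3)
  proof (induction xs)
    case Nil
    then show ?case using submonoid.one_closed[OF that(1)] by simp
  next
    case (Cons x xs)
    then show ?case using submonoid.m_closed[OF that(1)] that(2) by auto
  qed
  then show "P \<subseteq> generated_submonoid H (emb ` X)"
    unfolding generated_submonoid_def P_def by blast
qed

text \<open>In \<open>H\<close> each domino is the rebracketing of \<open>c (a r)\<close> as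
  \<open>(c a) r\<close>; the carry collects what has not yet been placed.\<close>

lemma emb_carry:
  assumes "y \<in> X" "range f \<subseteq> X"
  shows "emb y \<otimes> pr (map f [0..<K]) = pr (map (act y f) [0..<K]) \<otimes> emb (carry y f K)"
proof (induction K)
  case 0
  then show ?case using emb_closed assms by simp
next
  case (Suc K)
  define c where "c = carry y f K"
  define c' where "c' = carry y f (Suc K)"
  have f: "f n \<in> X" for n using assms by blast
  have c: "c \<in> X" "c' \<in> X" unfolding c_def c'_def by (rule carry_in[OF assms])+
  obtain a where a: "domino c (f K) a (act y f K) c'"
    using domino_head_rem[OF c(1) f] unfolding act_def c_def c'_def carry.simps by metis
  then have T: "T c a (act y f K)" "T a c' (f K)" unfolding domino_def by blast+
  have [simp]: "emb y \<in> carrier H" "emb c \<in> carrier H" "emb (f K) \<in> carrier H"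
    "emb a \<in> carrier H" "emb (act y f K) \<in> carrier H" "emb c' \<in> carrier H"
    using emb_closed f c assms(1) T T_closed by blast+
  have in_lists: "map f [0..<K] \<in> lists X" "[f K] \<in> lists X"
    "map (act y f) [0..<K] \<in> lists X" "[act y f K] \<in> lists X"
    using f act_in[OF assms] by auto
  have [simp]: "pr (map f [0..<K]) \<in> carrier H" "pr (map (act y f) [0..<K]) \<in> carrier H"
    using pr_closed in_lists by blast+
  have snoc: "pr (map f [0..<Suc K]) = pr (map f [0..<K]) \<otimes> emb (f K)"
    "pr (map (act y f) [0..<Suc K]) = pr (map (act y f) [0..<K]) \<otimes> emb (act y f K)"
    using pr_append[OF in_lists(1,2)] pr_append[OF in_lists(3,4)] by simp_all
  have "emb y \<otimes> pr (map f [0..<Suc K]) = (emb y \<otimes> pr (map f [0..<K])) \<otimes> emb (f K)"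
    unfolding snoc by (simp add: m_assoc)
  also have "\<dots> = pr (map (act y f) [0..<K]) \<otimes> (emb c \<otimes> (emb a \<otimes> emb c'))"
    unfolding Suc emb_mult[OF T(2)] c_def[symmetric] by (simp add: m_assoc)
  also have "\<dots> = pr (map (act y f) [0..<K]) \<otimes> (emb c \<otimes> emb a \<otimes> emb c')"
    by (simp add: m_assoc)
  also have "\<dots> = pr (map (act y f) [0..<Suc K]) \<otimes> emb c'"
    unfolding snoc emb_mult[OF T(1)] by (simp add: m_assoc)
  finally show ?case unfolding c'_def .
qed

lemma pr_supp_le:
  assumes "supp_le K f" "range f \<subseteq> X" "K \<le> L"
  shows "pr (map f [0..<L]) = pr (map f [0..<K])"
  using assms(3)
proof (induction L rule: dec_induct)
  case (step n)
  have f: "f k \<in> X" for k using assms(2) by blast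
  then have "map f [0..<n] \<in> lists X" "[f n] \<in> lists X" by auto
  then have "pr (map f [0..<Suc n]) = pr (map f [0..<n]) \<otimes> emb (f n)"
    using pr_append[of "map f [0..<n]" "[f n]"] emb_closed[OF f] by simp
  also have "f n = e" using assms(1) step.hyps by (simp add: supp_le_def)
  also have "pr (map f [0..<n]) \<otimes> emb e = pr (map f [0..<n])"
    unfolding emb_e by (rule r_one[OF pr_closed]) (use f in auto)
  finally show ?case using step.IH by (rule HOL.trans)
qed simp

lemma pr_nf:
  assumes "xs \<in> lists X" "supp_le K (nf xs)"
  shows "pr (map (nf xs) [0..<K]) = pr xs"
  using assms
proof (induction xs arbitrary: K rule: list.induct)
  case Nil
  have "supp_le 0 unit_seq" by (simp add: supp_le_def unit_seq_def)
  then have "pr (map unit_seq [0..<K]) = pr (map unit_seq [0..<0])"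
    by (rule pr_supp_le) (use e_in in \<open>auto simp: unit_seq_def\<close>)
  then show ?case by simp
next
  case (Cons x xs)
  have x: "x \<in> X" and xs: "xs \<in> lists X" using Cons.prems by auto
  have nrm: "normal (nf xs)" using normal_nf[OF xs] .
  then have ran: "range (nf xs) \<subseteq> X" using normal_def by blast
  have K: "supp_le K (nf xs)" using supp_le_actD[OF x nrm] Cons.prems by simp
  \<comment> \<open>One extra position is used so that the carry has certainly become
    \<open>e\<close> there.\<close>
  then have K': "supp_le (Suc K) (nf xs)" by (simp add: supp_le_def)
  have ran': "range (act x (nf xs)) \<subseteq> X" using act_in[OF x ran] by auto
  have "pr (x # xs) = emb x \<otimes> pr (map (nf xs) [0..<Suc K])"
    using Cons.IH[OF xs K'] by simp
  also have "\<dots> = pr (map (act x (nf xs)) [0..<Suc K]) \<otimes> emb (carry x (nf xs) (Suc K))"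
    by (rule emb_carry[OF x ran])
  also have "\<dots> = pr (map (act x (nf xs)) [0..<Suc K])"
  proof -
    have "carry x (nf xs) (Suc K) = e" by (rule carry_supp[OF x nrm K]) simp
    moreover have "pr (map (act x (nf xs)) [0..<Suc K]) \<in> carrier H"
      by (rule pr_closed) (use act_in[OF x ran] in auto)
    ultimately show ?thesis by (simp add: emb_e del: carry.simps)
  qed
  also have "\<dots> = pr (map (act x (nf xs)) [0..<K])"
    by (rule pr_supp_le) (use Cons.prems(2) ran' in auto)
  finally show ?case by simp
qed

lemma pre_refl: "a \<in> carrier H \<Longrightarrow> pre a a"
  unfolding pre_def using P_one by force

lemma pre_P: "a \<in> P \<Longrightarrow> pre a b \<Longrightarrow> b \<in> P"
  unfolding pre_def using P_mult by auto

lemma pre_one: "p \<in> P \<Longrightarrow> pre \<one> p"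
  unfolding pre_def using P_closed by auto

lemma pre_trans:
  assumes "a \<in> carrier H" "pre a b" "pre b c"
  shows "pre a c"
proof -
  obtain p q where pq: "p \<in> P" "q \<in> P" "b = a \<otimes> p" "c = b \<otimes> q"
    using assms pre_def by auto
  then have "c = a \<otimes> (p \<otimes> q)" using assms P_closed by (simp add: m_assoc)
  then show ?thesis using pq P_mult pre_def by blast
qed

text \<open>The empty word has normal form \<open>unit_seq\<close>, which only words in the letter
  \<open>e\<close> can reach.\<close>

lemma pr_eq_oneD:
  assumes "xs \<in> lists X" "pr xs = \<one>" "x \<in> set xs"
  shows "emb x = \<one>"
proof -
  have "nf xs = nf []" using assms by (intro nf_eqI) auto
  then have "set xs \<subseteq> {e}" using nf_eq_unit_seqD[OF assms(1)] by simp
  then show ?thesis using assms(3) emb_e by auto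
qed

lemma P_conical:
  assumes "p \<in> P" "q \<in> P" "p \<otimes> q = \<one>"
  shows "p = \<one>"
proof -
  obtain xs ys where xs: "xs \<in> lists X" "p = pr xs" and ys: "ys \<in> lists X" "q = pr ys"
    using assms P_cases by metis
  then have "pr (xs @ ys) = \<one>" using pr_append assms(3) by simp
  then have "\<forall>x\<in>set xs. emb x = \<one>" using pr_eq_oneD[of "xs @ ys"] xs ys by auto
  then have "pr xs = \<one>" by (induction xs) auto
  then show ?thesis using xs by simp
qed

lemma pre_antisym:
  assumes "a \<in> carrier H" "pre a b" "pre b a"
  shows "a = b"
proof -
  obtain p q where pq: "p \<in> P" "q \<in> P" "b = a \<otimes> p" "a = b \<otimes> q"
    using assms pre_def by auto
  have c: "p \<in> carrier H" "q \<in> carrier H" using pq P_closed by auto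
  have "a \<otimes> (p \<otimes> q) = a" using pq(3,4) assms(1) c m_assoc by metis
  then have "p \<otimes> q = \<one>" using assms(1) c by simp
  then have "p = \<one>" using pq(1,2) P_conical by blast
  then show ?thesis using pq(3) assms(1) by simp
qed

lemma pre_translate:
  assumes "g \<in> carrier H" "a \<in> carrier H" "b \<in> carrier H"
  shows "pre (g \<otimes> a) (g \<otimes> b) \<longleftrightarrow> pre a b"
  unfolding pre_def using assms P_closed by (auto simp: m_assoc)

lemma pre_emb: "T x y z \<Longrightarrow> pre (emb x) (emb z)"
  unfolding pre_def using emb_mult emb_in_P T_closed by metis

lemma leq_pre: "leq x y \<Longrightarrow> pre (emb x) (emb y)"
  unfolding leq_def using pre_emb by blast

text \<open>If \<open>emb x\<close> divides, then \<open>x\<close> begins some word for the element,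
  and acting by \<open>x\<close> yields a first entry above \<open>x\<close>. Conversely,
  multiplying the normal form back shows that its first entry divides.\<close>

lemma pre_emb_head:
  assumes "x \<in> X" "xs \<in> lists X"
  shows "pre (emb x) (pr xs) \<longleftrightarrow> leq x (nf xs 0)"
proof
  assume "pre (emb x) (pr xs)"
  then obtain ys where ys: "ys \<in> lists X" "pr xs = pr (x # ys)"
    unfolding pre_def using P_cases by (metis pr_simps(2))
  then have "nf xs = act x (nf ys)" using nf_eqI[of xs "x # ys"] assms by simp
  then show "leq x (nf xs 0)" using leq_act normal_nf ys assms by metis
next
  assume leq: "leq x (nf xs 0)"
  have ran: "nf xs n \<in> X" for n using normal_nf normal_in assms by blast
  obtain K where "supp_le K (nf xs)" using supp_le_nf assms by blast
  then have "supp_le (Suc K) (nf xs)" by (simp add: supp_le_def)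
  then have "pr xs = pr (map (nf xs) [0..<Suc K])" using pr_nf assms by metis
  also have "\<dots> = emb (nf xs 0) \<otimes> pr (map (nf xs) [Suc 0..<Suc K])"
    by (simp only: upt_rec[of 0 "Suc K"] list.map) simp
  finally have "pre (emb (nf xs 0)) (pr xs)"
    unfolding pre_def using pr_in_P ran by (metis (no_types, lifting) imageE in_lists_conv_set list.set_map)
  then show "pre (emb x) (pr xs)"
    using leq_pre[OF leq] pre_trans emb_closed assms by blast
qed

section \<open>Least common multiples\<close>

definition lub_of :: "'g \<Rightarrow> 'g \<Rightarrow> 'g \<Rightarrow> bool" where
  "lub_of a b j \<longleftrightarrow> j \<in> carrier H \<and> pre a j \<and> pre b j \<and>
    (\<forall>m\<in>carrier H. pre a m \<longrightarrow> pre b m \<longrightarrow> pre j m)"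

definition glb_of :: "'g \<Rightarrow> 'g \<Rightarrow> 'g \<Rightarrow> bool" where
  "glb_of a b j \<longleftrightarrow> j \<in> carrier H \<and> pre j a \<and> pre j b \<and>
    (\<forall>m\<in>carrier H. pre m a \<longrightarrow> pre m b \<longrightarrow> pre m j)"

lemma lub_of_sym: "lub_of a b j \<longleftrightarrow> lub_of b a j"
  unfolding lub_of_def by blast

text \<open>Two tiles side by side: a common multiple of \<open>a \<otimes> a'\<close> and
  \<open>b\<close> is a multiple \<open>a \<otimes> m'\<close> of \<open>a \<otimes> b'\<close>, and
  cancelling \<open>a\<close> leaves a common multiple \<open>m'\<close> of \<open>a'\<close> and
  \<open>b'\<close>.\<close>

lemma lub_of_tile:
  assumes "a \<in> P" "b \<in> P" "a' \<in> P" "b' \<in> carrier H"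
    and 0: "lub_of a b (a \<otimes> b')" and 1: "lub_of a' b' j"
  shows "lub_of (a \<otimes> a') b (a \<otimes> j)"
proof -
  have c: "a \<in> carrier H" "b \<in> carrier H" "a' \<in> carrier H" "j \<in> carrier H"
    using assms P_closed lub_of_def by auto
  have "pre (a \<otimes> j) m" if m: "m \<in> carrier H" "pre (a \<otimes> a') m" "pre b m" for m
  proof -
    have "pre a (a \<otimes> a')" using assms pre_def by blast
    then have am: "pre a m" using m c pre_trans by blast
    then obtain m' where m': "m' \<in> P" "m = a \<otimes> m'" using pre_def by blast
    have "pre (a \<otimes> b') m" using 0 m am unfolding lub_of_def by blast
    then have "pre b' m'" "pre a' m'"
      using m m' pre_translate c assms(4) P_closed by metis+
    then have "pre j m'" using 1 m' P_closed unfolding lub_of_def by blast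
    then show ?thesis using m' pre_translate c P_closed by metis
  qed
  moreover have "pre (a \<otimes> a') (a \<otimes> j)" using 1 pre_translate c unfolding lub_of_def by blast
  moreover have "pre b (a \<otimes> j)"
    using 0 1 pre_translate[of a b' j] pre_trans[of b] c assms(4) unfolding lub_of_def by blast
  ultimately show ?thesis unfolding lub_of_def using c by blast
qed

text \<open>Divisibility by elements of \<open>X\<close> is read off the first entry of the normal
  form, so the join in the germ is also the least common multiple in \<open>H\<close>.\<close>

lemma lub_of_emb:
  assumes "x \<in> X" "y \<in> X"
  obtains z where "lub_of (emb x) (emb y) (emb z)" "leq x z" "leq y z"
proof -
  obtain z where z: "leq x z" "leq y z" "\<And>w. leq x w \<Longrightarrow> leq y w \<Longrightarrow> leq z w"
    using join_exists[OF assms] by blast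
  have zX: "z \<in> X" using z leq_in by blast
  have "pre (emb z) m" if m: "m \<in> carrier H" "pre (emb x) m" "pre (emb y) m" for m
  proof -
    have "m \<in> P" using m assms emb_in_P pre_P by blast
    then obtain xs where "xs \<in> lists X" "m = pr xs" by (rule P_cases)
    then show ?thesis using m z(3) pre_emb_head assms zX by metis
  qed
  then have "lub_of (emb x) (emb y) (emb z)"
    unfolding lub_of_def using z zX emb_closed leq_pre by blast
  then show ?thesis using z that by blast
qed

text \<open>One row of tiles. After passing \<open>y\<close>, the element \<open>x\<close> turns
  into the \<open>x'\<close> with \<open>y x'\<close> the join of \<open>x\<close> and
  \<open>y\<close>; it lies in \<open>X\<close> again, so the induction continues with it.\<close>

lemma lub_of_emb_pr:
  assumes "ys \<in> lists X" "x \<in> X"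
  shows "\<exists>j. lub_of (emb x) (pr ys) j"
  using assms
proof (induction ys arbitrary: x rule: list.induct)
  case Nil
  then have "lub_of (emb x) \<one> (emb x)"
    unfolding lub_of_def using emb_closed pre_refl pre_one emb_in_P by blast
  then show ?case by auto
next
  case (Cons y ys)
  then have y: "y \<in> X" "ys \<in> lists X" by auto
  obtain z where z: "lub_of (emb x) (emb y) (emb z)" "leq y z" using lub_of_emb Cons.prems y by metis
  then obtain x' where x': "T y x' z" using leq_def by blast
  then have x'X: "x' \<in> X" using T_closed by blast
  obtain j where j: "lub_of (emb x') (pr ys) j" using Cons.IH[OF y(2) x'X] by blast
  have "lub_of (emb y \<otimes> pr ys) (emb x) (emb y \<otimes> j)"
    by (rule lub_of_tile[where b' = "emb x'"])
      (use y Cons.prems x'X z j emb_in_P pr_in_P emb_closed emb_mult[OF x'] lub_of_sym in auto)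
  then show ?case using lub_of_sym by auto
qed

lemma lub_exists_P:
  assumes "a \<in> P" "b \<in> P"
  shows "\<exists>j. lub_of a b j"
proof -
  obtain xs where xs: "xs \<in> lists X" "a = pr xs" using assms P_cases by metis
  have "\<exists>j. lub_of (pr xs) b j" using xs(1) assms(2)
  proof (induction xs arbitrary: b rule: list.induct)
    case Nil
    then have "lub_of \<one> b b"
      unfolding lub_of_def using P_closed pre_refl pre_one by blast
    then show ?case by auto
  next
    case (Cons x xs)
    then have x: "x \<in> X" "xs \<in> lists X" by auto
    obtain j where j: "lub_of (emb x) b j" using lub_of_emb_pr x Cons.prems P_cases by metis
    then obtain b' where b': "b' \<in> P" "j = emb x \<otimes> b'" unfolding lub_of_def pre_def by blast
    obtain k where k: "lub_of (pr xs) b' k" using Cons.IH x b' by blast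
    have "lub_of (emb x \<otimes> pr xs) b (emb x \<otimes> k)"
      by (rule lub_of_tile[where b' = b']) (use x Cons.prems b' j k emb_in_P pr_in_P P_closed in auto)
    then show ?case by auto
  qed
  then show ?thesis using xs by simp
qed

section \<open>Clearing denominators with the central element\<close>

lemma emb_d_closed: "emb d \<in> carrier H"
  using emb_closed d_in .

lemma commute_inv:
  assumes "a \<in> carrier H" "b \<in> carrier H" "a \<otimes> b = b \<otimes> a"
  shows "a \<otimes> inv b = inv b \<otimes> a"
proof -
  have "a \<otimes> inv b = inv b \<otimes> (b \<otimes> a) \<otimes> inv b"
    using assms(1,2) by (simp add: inv_mult_cancel)
  also have "\<dots> = inv b \<otimes> a"
    unfolding assms(3)[symmetric] using assms(1,2) by (simp add: m_assoc)
  finally show ?thesis .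
qed

text \<open>For generators this is the two-sided complement: \<open>d = x y = y x\<close> gives
  \<open>d x = x y x = x d\<close>.\<close>

lemma emb_d_central: "h \<in> carrier H \<Longrightarrow> emb d \<otimes> h = h \<otimes> emb d"
proof -
  have X: "emb d \<otimes> emb x = emb x \<otimes> emb d" if x: "x \<in> X" for x
  proof -
    obtain y where y: "T x y d" "T y x d" using complement x by blast
    then have "emb d = emb x \<otimes> emb y" "emb d = emb y \<otimes> emb x" using emb_mult by auto
    moreover have "emb x \<in> carrier H" "emb y \<in> carrier H" using y T_closed emb_closed by auto
    ultimately show ?thesis using m_assoc by metis
  qed
  assume "h \<in> carrier H"
  then have "h \<in> generate H (emb ` X)" using emb_generate by simp
  then have "h \<in> carrier H \<and> emb d \<otimes> h = h \<otimes> emb d"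
  proof induction
    case one
    then show ?case using emb_d_closed by simp
  next
    case (incl h)
    then show ?case using X emb_closed by auto
  next
    case (inv h)
    then show ?case using X emb_closed commute_inv emb_d_closed by auto
  next
    case (eng h1 h2)
    then show ?case using emb_d_closed by (metis m_assoc m_closed)
  qed
  then show ?thesis by blast
qed

lemma pow_d_central: "h \<in> carrier H \<Longrightarrow> emb d [^] (n::nat) \<otimes> h = h \<otimes> emb d [^] n"
proof (induction n)
  case (Suc n)
  have "emb d [^] n \<in> carrier H" using emb_d_closed by simp
  then show ?case using Suc emb_d_central emb_d_closed by (metis m_assoc nat_pow_Suc)
qed simp

lemma pow_d_P: "emb d [^] (n::nat) \<in> P"
  by (induction n) (auto simp: P_one intro: P_mult emb_in_P d_in)

text \<open>The inverse of \<open>emb x\<close> is its complement divided by \<open>emb d\<close>,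
  so a large power of the central \<open>emb d\<close> makes any element positive. Order questions
  in \<open>H\<close> thereby reduce to \<open>P\<close>.\<close>

lemma pow_d_shift: "h \<in> carrier H \<Longrightarrow> \<exists>n::nat. h \<otimes> emb d [^] n \<in> P"
proof -
  assume "h \<in> carrier H"
  then have "h \<in> generate H (emb ` X)" using emb_generate by simp
  then show ?thesis
  proof induction
    case one
    show ?case using P_one by (intro exI[of _ 0]) simp
  next
    case (incl h)
    then show ?case using emb_in_P emb_closed by (intro exI[of _ 0]) auto
  next
    case (inv h)
    then obtain x where x: "x \<in> X" "h = emb x" by blast
    then obtain y where y: "T x y d" using complement by blast
    then have "y \<in> X" using T_closed by blast
    moreover have "inv h \<otimes> emb d = emb y"
      using emb_mult[OF y] x emb_closed \<open>y \<in> X\<close> by (metis inv_solve_left m_closed inv_closed)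
    ultimately show ?case using emb_in_P emb_d_closed by (intro exI[of _ 1]) auto
  next
    case (eng h1 h2)
    then obtain n m :: nat where nm: "h1 \<otimes> emb d [^] n \<in> P" "h2 \<otimes> emb d [^] m \<in> P" by blast
    have c: "h1 \<in> carrier H" "h2 \<in> carrier H" using eng emb_generate by auto
    let ?n = "emb d [^] n" and ?m = "emb d [^] m"
    have nm_c: "?n \<in> carrier H" "?m \<in> carrier H" using emb_d_closed by auto
    have "h1 \<otimes> h2 \<otimes> emb d [^] (n + m) = h1 \<otimes> (h2 \<otimes> ?n) \<otimes> ?m"
      unfolding nat_pow_mult[OF emb_d_closed, symmetric] using c nm_c by (simp add: m_assoc)
    also have "\<dots> = h1 \<otimes> (?n \<otimes> h2) \<otimes> ?m"
      using c pow_d_central[of h2 n] by simp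
    also have "\<dots> = (h1 \<otimes> ?n) \<otimes> (h2 \<otimes> ?m)"
      using c nm_c by (simp add: m_assoc)
    finally show ?case using nm P_mult by metis
  qed
qed

lemma pow_d_shift_add:
  assumes "h \<in> carrier H" "h \<otimes> emb d [^] (n::nat) \<in> P"
  shows "h \<otimes> emb d [^] (n + m) \<in> P"
  using P_mult[OF assms(2) pow_d_P[of m]] assms(1) emb_d_closed
  unfolding nat_pow_mult[OF emb_d_closed, symmetric] by (simp add: m_assoc)

lemma pow_d_shift2:
  assumes "a \<in> carrier H" "b \<in> carrier H"
  obtains n :: nat where "a \<otimes> emb d [^] n \<in> P" "b \<otimes> emb d [^] n \<in> P"
proof -
  obtain n m :: nat where "a \<otimes> emb d [^] n \<in> P" "b \<otimes> emb d [^] m \<in> P"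
    using assms pow_d_shift by blast
  then have "a \<otimes> emb d [^] (n + m) \<in> P" "b \<otimes> emb d [^] (n + m) \<in> P"
    using pow_d_shift_add assms by (auto, metis add.commute)
  then show ?thesis using that by blast
qed

lemma pre_pow_d:
  assumes "a \<in> carrier H" "b \<in> carrier H"
  shows "pre (a \<otimes> emb d [^] (n::nat)) (b \<otimes> emb d [^] n) \<longleftrightarrow> pre a b"
  using assms pre_translate[of "emb d [^] n"] pow_d_central emb_d_closed by (metis nat_pow_closed)

lemma lub_exists:
  assumes "a \<in> carrier H" "b \<in> carrier H"
  shows "\<exists>j. lub_of a b j"
proof -
  obtain n :: nat where n: "a \<otimes> emb d [^] n \<in> P" "b \<otimes> emb d [^] n \<in> P"
    using pow_d_shift2[OF assms] .
  then obtain j where j: "lub_of (a \<otimes> emb d [^] n) (b \<otimes> emb d [^] n) j" using lub_exists_P by blast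
  have c: "emb d [^] n \<in> carrier H" "j \<in> carrier H" using emb_d_closed j lub_of_def by auto
  define k where "k = j \<otimes> inv (emb d [^] n)"
  have k: "k \<in> carrier H" "j = k \<otimes> emb d [^] n" using c by (auto simp: k_def m_assoc)
  have "pre k m" if m: "m \<in> carrier H" "pre a m" "pre b m" for m
  proof -
    have "pre (a \<otimes> emb d [^] n) (m \<otimes> emb d [^] n)" "pre (b \<otimes> emb d [^] n) (m \<otimes> emb d [^] n)"
      using m pre_pow_d assms by blast+
    then have "pre (k \<otimes> emb d [^] n) (m \<otimes> emb d [^] n)"
      using j m(1) c(1) unfolding lub_of_def k(2) by blast
    then show ?thesis using pre_pow_d m(1) k(1) by blast
  qed
  moreover have "pre a k" "pre b k"
    using j k(1) pre_pow_d assms unfolding lub_of_def k(2) by blast+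
  ultimately have "lub_of a b k"
    unfolding lub_of_def using k(1) by blast
  then show ?thesis by blast
qed

section \<open>Finiteness of divisors and greatest common divisors\<close>

text \<open>The normal form of a right divisor is no longer than that of \<open>g\<close>; padded
  with \<open>e\<close> it is a word of length \<open>K\<close> over the finite set
  \<open>X\<close>.\<close>

lemma finite_right_divisors:
  assumes "g \<in> P"
  shows "finite {q \<in> P. \<exists>p\<in>P. g = p \<otimes> q}"
proof -
  obtain xs where xs: "xs \<in> lists X" "g = pr xs" using assms P_cases by metis
  obtain K where K: "supp_le K (nf xs)" using supp_le_nf xs by blast
  have "q \<in> pr ` {l. set l \<subseteq> X \<and> length l = K}" if q: "q \<in> P" "p \<in> P" "g = p \<otimes> q" for p q
  proof -
    obtain zs where zs: "zs \<in> lists X" "p = pr zs" using q(2) by (rule P_cases)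
    obtain ys where ys: "ys \<in> lists X" "q = pr ys" using q(1) by (rule P_cases)
    have "pr (zs @ ys) = g" using pr_append[OF zs(1) ys(1)] zs(2) ys(2) q(3) by metis
    moreover have "zs @ ys \<in> lists X" using zs(1) ys(1) by simp
    ultimately have "nf (zs @ ys) = nf xs" using nf_eqI xs by metis
    then have "supp_le K (nf (zs @ ys))" using K by metis
    \<comment> \<open>The letters of \<open>zs\<close> are stripped one at a time, and none of them
      can have shortened the normal form.\<close>
    with zs(1) have "supp_le K (nf ys)"
    proof (induction zs rule: lists.induct)
      case (Cons z zs)
      then show ?case using supp_le_actD[of z "nf (zs @ ys)" K] normal_nf[of "zs @ ys"] ys(1) by simp
    qed simp
    then have "q = pr (map (nf ys) [0..<K])" using pr_nf ys by metis
    moreover have "set (map (nf ys) [0..<K]) \<subseteq> X" using normal_in normal_nf ys(1) by auto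
    ultimately show ?thesis by (intro image_eqI[of _ _ "map (nf ys) [0..<K]"]) auto
  qed
  then have "{q \<in> P. \<exists>p\<in>P. g = p \<otimes> q} \<subseteq> pr ` {l. set l \<subseteq> X \<and> length l = K}" by blast
  then show ?thesis by (rule finite_subset) (intro finite_imageI finite_lists_length_eq finite_X)
qed

lemma finite_left_divisors:
  assumes "g \<in> P"
  shows "finite {p \<in> P. pre p g}"
proof -
  have "p \<in> (\<lambda>q. g \<otimes> inv q) ` {q \<in> P. \<exists>p\<in>P. g = p \<otimes> q}" if p: "p \<in> P" "pre p g" for p
  proof -
    obtain q where q: "q \<in> P" "g = p \<otimes> q" using p pre_def by blast
    then have "p = g \<otimes> inv q" using p P_closed inv_solve_right m_closed by metis
    then show ?thesis using p q by blast
  qed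
  then show ?thesis using finite_right_divisors[OF assms] by (blast intro: finite_surj)
qed

lemma glb_exists_P:
  assumes "a \<in> P" "b \<in> P"
  shows "\<exists>m\<in>P. glb_of a b m"
proof -
  let ?D = "{p \<in> P. pre p a \<and> pre p b}"
  \<comment> \<open>Membership in \<open>P\<close> is built into the relation so that its
    transitivity holds unconditionally; \<open>pre_trans\<close> needs its first argument in the
    carrier.\<close>
  have ex: "\<exists>m\<in>?D. \<forall>x\<in>?D. x \<in> P \<and> pre x m"
  proof (rule finite_directed_max)
    show "finite ?D" by (rule finite_subset[OF _ finite_left_divisors[OF assms(1)]]) auto
    show "?D \<noteq> {}" using assms P_one pre_one by blast
    show "\<exists>z\<in>?D. (x \<in> P \<and> pre x z) \<and> y \<in> P \<and> pre y z" if xy: "x \<in> ?D" "y \<in> ?D" for x y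
    proof -
      obtain j where j: "lub_of x y j" using xy lub_exists_P by blast
      then have "pre x j" "pre y j" "pre j a" "pre j b" using xy assms P_closed unfolding lub_of_def by auto
      then show ?thesis using xy pre_P by blast
    qed
    show "x \<in> P \<and> pre x z" if "x \<in> P \<and> pre x y" "y \<in> P \<and> pre y z" for x y z
      using that pre_trans P_closed by blast
  qed
  then obtain m where m: "m \<in> P" "pre m a" "pre m b" "\<And>x. x \<in> P \<Longrightarrow> pre x a \<Longrightarrow> pre x b \<Longrightarrow> pre x m"
    by blast
  \<comment> \<open>So far \<open>m\<close> is greatest only among positive lower bounds. For
    arbitrary \<open>c\<close> the join of \<open>c\<close> and \<open>m\<close> is a lower bound
    too, and positive because it lies above \<open>m\<close>; hence it is \<open>m\<close>
    itself.\<close>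
  have "pre c m" if c: "c \<in> carrier H" "pre c a" "pre c b" for c
  proof -
    obtain j where j: "lub_of c m j" using c m P_closed lub_exists by blast
    then have "pre m j" "pre c j" "pre j a" "pre j b" using c m assms P_closed unfolding lub_of_def by auto
    moreover from this have "pre j m" using m pre_P by blast
    ultimately show ?thesis using pre_trans c by blast
  qed
  then show ?thesis using m P_closed unfolding glb_of_def by blast
qed

lemma glb_exists:
  assumes "a \<in> carrier H" "b \<in> carrier H"
  shows "\<exists>j. glb_of a b j"
proof -
  obtain n :: nat where n: "a \<otimes> emb d [^] n \<in> P" "b \<otimes> emb d [^] n \<in> P"
    using pow_d_shift2[OF assms] .
  then obtain j where j: "glb_of (a \<otimes> emb d [^] n) (b \<otimes> emb d [^] n) j" using glb_exists_P by blast
  have c: "emb d [^] n \<in> carrier H" "j \<in> carrier H" using emb_d_closed j glb_of_def by auto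
  define k where "k = j \<otimes> inv (emb d [^] n)"
  have k: "k \<in> carrier H" "j = k \<otimes> emb d [^] n" using c by (auto simp: k_def m_assoc)
  have "pre m k" if m: "m \<in> carrier H" "pre m a" "pre m b" for m
  proof -
    have "pre (m \<otimes> emb d [^] n) (a \<otimes> emb d [^] n)" "pre (m \<otimes> emb d [^] n) (b \<otimes> emb d [^] n)"
      using m pre_pow_d assms by blast+
    then have "pre (m \<otimes> emb d [^] n) (k \<otimes> emb d [^] n)"
      using j m(1) c(1) unfolding glb_of_def k(2) by blast
    then show ?thesis using pre_pow_d m(1) k(1) by blast
  qed
  moreover have "pre k a" "pre k b"
    using j k(1) pre_pow_d assms unfolding glb_of_def k(2) by blast+
  ultimately have "glb_of a b k"
    unfolding glb_of_def using k(1) by blast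
  then show ?thesis by blast
qed

section \<open>Verification of the Garside axioms\<close>

lemma left_le_pre: "left_le H P a b \<longleftrightarrow> pre a b"
  by (auto simp: left_le_def pre_def l_coset_def)

lemma right_le_pre:
  assumes "a \<in> carrier H" "b \<in> carrier H"
  shows "right_le H P a b \<longleftrightarrow> pre (inv b) (inv a)"
proof -
  have "b = p \<otimes> a \<longleftrightarrow> inv a = inv b \<otimes> p" if "p \<in> P" for p
  proof
    have p: "p \<in> carrier H" using P_closed[OF that] .
    show "inv a = inv b \<otimes> p" if "b = p \<otimes> a"
      unfolding that using assms(1) p by (simp add: inv_mult_group m_assoc)
    show "b = p \<otimes> a" if "inv a = inv b \<otimes> p"
    proof -
      have "inv (inv a) = inv p \<otimes> b" unfolding that using assms(2) p by (simp add: inv_mult_group)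
      then show ?thesis using assms p by (simp add: inv_mult_cancel)
    qed
  qed
  then show ?thesis by (auto simp: right_le_def pre_def r_coset_def)
qed

lemma lattice_left: "Lattice.lattice \<lparr>carrier = P, eq = (=), le = left_le H P\<rparr>"
proof (rule latticeI, unfold left_le_pre)
  show "\<exists>s\<in>P. pre x s \<and> pre y s \<and> (\<forall>z\<in>P. pre x z \<longrightarrow> pre y z \<longrightarrow> pre s z)"
    if xy: "x \<in> P" "y \<in> P" for x y
  proof -
    obtain j where j: "lub_of x y j" using lub_exists_P[OF xy] by blast
    then have "pre x j" "pre y j" unfolding lub_of_def by blast+
    moreover from this have "j \<in> P" using pre_P xy by blast
    moreover have "pre j z" if "z \<in> P" "pre x z" "pre y z" for z
      using j that P_closed[OF that(1)] unfolding lub_of_def by blast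
    ultimately show ?thesis by blast
  qed
  show "\<exists>s\<in>P. pre s x \<and> pre s y \<and> (\<forall>z\<in>P. pre z x \<longrightarrow> pre z y \<longrightarrow> pre z s)"
    if xy: "x \<in> P" "y \<in> P" for x y
  proof -
    obtain j where j: "j \<in> P" "glb_of x y j" using glb_exists_P[OF xy] by blast
    then have "pre j x" "pre j y" unfolding glb_of_def by blast+
    moreover have "pre z j" if "z \<in> P" "pre z x" "pre z y" for z
      using j that P_closed[OF that(1)] unfolding glb_of_def by blast
    ultimately show ?thesis using j(1) by blast
  qed
  show "pre x x" if "x \<in> P" for x using pre_refl[OF P_closed[OF that]] .
  show "x = y" if "x \<in> P" "y \<in> P" "pre x y" "pre y x" for x y
    using pre_antisym[OF P_closed[OF that(1)] that(3,4)] .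
  show "pre x z" if "x \<in> P" "y \<in> P" "z \<in> P" "pre x y" "pre y z" for x y z
    using pre_trans[OF P_closed[OF that(1)] that(4,5)] .
qed

text \<open>Inversion is an order-reversing bijection between the right order and the left order of
  the group, in which the positive elements are the inverses of those below \<open>\<one>\<close>.\<close>

lemma lattice_right: "Lattice.lattice \<lparr>carrier = P, eq = (=), le = right_le H P\<rparr>"
proof (rule latticeI)
  show "right_le H P x x" if "x \<in> P" for x
    using P_closed[OF that] by (simp add: right_le_pre pre_refl)
  show "x = y" if "x \<in> P" "y \<in> P" "right_le H P x y" "right_le H P y x" for x y
  proof -
    have c: "x \<in> carrier H" "y \<in> carrier H" using that P_closed by auto
    then have "inv x = inv y" using that(3,4) by (intro pre_antisym) (simp_all add: right_le_pre)
    then show ?thesis using c inv_inv by metis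
  qed
  show "right_le H P x z" if "x \<in> P" "y \<in> P" "z \<in> P" "right_le H P x y" "right_le H P y z" for x y z
  proof -
    have c: "x \<in> carrier H" "y \<in> carrier H" "z \<in> carrier H" using that P_closed by auto
    then show ?thesis
      using that(4,5) pre_trans[of "inv z" "inv y" "inv x"] by (simp add: right_le_pre)
  qed
  show "\<exists>s\<in>P. right_le H P x s \<and> right_le H P y s \<and>
      (\<forall>z\<in>P. right_le H P x z \<longrightarrow> right_le H P y z \<longrightarrow> right_le H P s z)"
    if xy: "x \<in> P" "y \<in> P" for x y
  proof -
    have c: "x \<in> carrier H" "y \<in> carrier H" using xy P_closed by auto
    obtain j where j: "glb_of (inv x) (inv y) j" using glb_exists c by blast
    then have jc: "j \<in> carrier H" unfolding glb_of_def by blast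
    then obtain p where p: "p \<in> P" "inv x = j \<otimes> p" using j unfolding glb_of_def pre_def by blast
    have pc: "p \<in> carrier H" using P_closed[OF p(1)] .
    have "x = inv (j \<otimes> p)" unfolding p(2)[symmetric] using c by simp
    \<comment> \<open>The inverse of the left meet is a positive multiple of \<open>x\<close>, hence
      itself positive.\<close>
    then have "inv j = p \<otimes> x" using jc pc by (simp add: inv_mult_group inv_mult_cancel)
    then have "inv j \<in> P" using P_mult[OF p(1) xy(1)] by metis
    moreover have "right_le H P x (inv j)" "right_le H P y (inv j)"
      using j jc c unfolding right_le_pre[OF c(1) inv_closed[OF jc]] right_le_pre[OF c(2) inv_closed[OF jc]]
      by (simp_all add: glb_of_def)
    moreover have "right_le H P (inv j) z" if z: "z \<in> P" "right_le H P x z" "right_le H P y z" for z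
    proof -
      have zc: "z \<in> carrier H" using z P_closed by blast
      have "pre (inv z) (inv x)" "pre (inv z) (inv y)" using z(2,3) unfolding right_le_pre[OF c(1) zc] right_le_pre[OF c(2) zc] .
      then have "pre (inv z) j" using j inv_closed[OF zc] unfolding glb_of_def by blast
      then show ?thesis using right_le_pre[OF inv_closed[OF jc] zc] jc by simp
    qed
    ultimately show ?thesis by blast
  qed
  show "\<exists>s\<in>P. right_le H P s x \<and> right_le H P s y \<and>
      (\<forall>z\<in>P. right_le H P z x \<longrightarrow> right_le H P z y \<longrightarrow> right_le H P z s)"
    if xy: "x \<in> P" "y \<in> P" for x y
  proof -
    have c: "x \<in> carrier H" "y \<in> carrier H" using xy P_closed by auto
    obtain j where j: "lub_of (inv x) (inv y) j" using lub_exists c by blast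
    then have jc: "j \<in> carrier H" unfolding lub_of_def by blast
    \<comment> \<open>As \<open>x\<close> and \<open>y\<close> are positive, \<open>\<one>\<close>
      bounds both inverses from above; their join lies below it and so has a positive
      inverse.\<close>
    have "pre (inv x) \<one>" "pre (inv y) \<one>"
      unfolding pre_def using l_inv[OF c(1), symmetric] l_inv[OF c(2), symmetric] xy by blast+
    then have "pre j \<one>" using j unfolding lub_of_def by blast
    then obtain p where p: "p \<in> P" "\<one> = j \<otimes> p" unfolding pre_def by blast
    then have "inv j \<otimes> \<one> = p" using inv_mult_cancel(1)[OF jc P_closed[OF p(1)]] by metis
    then have "inv j = p" using jc by simp
    then have "inv j \<in> P" using p(1) by simp
    moreover have "right_le H P (inv j) x" "right_le H P (inv j) y"
      using j jc c unfolding right_le_pre[OF inv_closed[OF jc] c(1)] right_le_pre[OF inv_closed[OF jc] c(2)]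
      by (simp_all add: lub_of_def)
    moreover have "right_le H P z (inv j)" if z: "z \<in> P" "right_le H P z x" "right_le H P z y" for z
    proof -
      have zc: "z \<in> carrier H" using z P_closed by blast
      have "pre (inv x) (inv z)" "pre (inv y) (inv z)" using z(2,3) unfolding right_le_pre[OF zc c(1)] right_le_pre[OF zc c(2)] .
      then have "pre j (inv z)" using j inv_closed[OF zc] unfolding lub_of_def by blast
      then show ?thesis using right_le_pre[OF zc inv_closed[OF jc]] jc by simp
    qed
    ultimately show ?thesis by blast
  qed
qed

text \<open>The word \<open>x # y # ys\<close> has the normal form of \<open>d\<close>, so
  \<open>x\<close> times the first entry after it is \<open>d\<close> in the germ. That entry is a
  multiple of \<open>y\<close>, and factors of defined products are defined.\<close>

lemma divisor_d_mult:
  assumes "x \<in> X" "y \<in> X" "q \<in> P" "emb x \<otimes> (emb y \<otimes> q) = emb d"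
  shows "\<exists>z. T x y z"
proof -
  obtain ys where ys: "ys \<in> lists X" "q = pr ys" using assms P_cases by metis
  have "nf (x # y # ys) = nf [d]"
    by (rule nf_eqI) (use assms ys d_in emb_d_closed in auto)
  then have "T x (nf (y # ys) 0) d"
    using act_eq_d[of x "nf (y # ys)"] assms ys normal_nf[of "y # ys"] by auto
  moreover have "leq y (nf (y # ys) 0)" using leq_act assms ys normal_nf by simp
  ultimately show ?thesis using assoc2 leq_def by blast
qed

lemma emb_d_flip:
  assumes "g \<in> carrier H" "q \<in> carrier H" "g \<otimes> q = emb d"
  shows "q \<otimes> g = emb d"
proof -
  have "q = inv g \<otimes> emb d" using assms emb_d_closed by (metis inv_solve_left)
  then have "q \<otimes> g = inv g \<otimes> (g \<otimes> emb d)" using assms emb_d_closed emb_d_central by (simp add: m_assoc)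
  then show ?thesis using assms emb_d_closed by (simp add: m_assoc[symmetric])
qed

text \<open>Centrality of \<open>d\<close> allows cyclic rotation: from \<open>x (xs q) = d\<close>
  follows \<open>xs (q x) = d\<close>, so the tail \<open>xs\<close> is itself a left divisor of
  \<open>d\<close> and the induction hypothesis applies to it.\<close>

lemma divisor_d_in:
  assumes "g \<in> P" "pre g (emb d)"
  shows "g \<in> emb ` X"
proof -
  obtain xs where xs: "xs \<in> lists X" "g = pr xs" using assms P_cases by metis
  obtain q where q: "q \<in> P" "pr xs \<otimes> q = emb d" using assms xs pre_def by metis
  have "pr xs \<in> emb ` X" using xs(1) q
  proof (induction xs arbitrary: q rule: list.induct)
    case Nil
    then show ?case using emb_e e_in by force
  next
    case (Cons x xs)
    then have x: "x \<in> X" "xs \<in> lists X" "emb x \<in> carrier H" "pr xs \<in> carrier H" "q \<in> carrier H"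
      using emb_closed pr_closed P_closed by auto
    have eq: "emb x \<otimes> (pr xs \<otimes> q) = emb d" using Cons.prems x by (simp add: m_assoc)
    then have "pr xs \<otimes> (q \<otimes> emb x) = emb d" using emb_d_flip x by (metis m_assoc m_closed)
    moreover have "q \<otimes> emb x \<in> P" using P_mult Cons.prems x emb_in_P by blast
    ultimately obtain y where y: "y \<in> X" "pr xs = emb y" using Cons.IH x by blast
    then obtain z where "T x y z"
      using divisor_d_mult[OF x(1) y(1) Cons.prems(2)] eq by metis
    then have "pr (x # xs) = emb z" "z \<in> X" using emb_mult T_closed y by auto
    then show ?case by blast
  qed
  then show ?thesis using xs by blast
qed

lemma emb_X_left: "emb ` X = {g \<in> P. left_le H P \<one> g \<and> left_le H P g (emb d)}"
proof (intro equalityI subsetI CollectI conjI)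
  fix g assume "g \<in> emb ` X"
  then obtain x where x: "x \<in> X" "g = emb x" by blast
  show "g \<in> P" "left_le H P \<one> g" "left_le H P g (emb d)"
    unfolding left_le_pre using x emb_in_P pre_one leq_pre[OF leq_d] by auto
next
  fix g assume "g \<in> {g \<in> P. left_le H P \<one> g \<and> left_le H P g (emb d)}"
  then show "g \<in> emb ` X" using divisor_d_in left_le_pre by blast
qed

lemma emb_X_right: "emb ` X = {g \<in> P. right_le H P \<one> g \<and> right_le H P g (emb d)}"
proof -
  have "right_le H P \<one> g \<longleftrightarrow> left_le H P \<one> g" if "g \<in> P" for g
    using P_closed[OF that] P_closed
    unfolding left_le_def right_le_def l_coset_def r_coset_def by (auto 4 3)
  moreover have "right_le H P g (emb d) \<longleftrightarrow> left_le H P g (emb d)" if "g \<in> P" for g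
  proof -
    have "emb d = p \<otimes> g \<longleftrightarrow> emb d = g \<otimes> p" if "p \<in> P" for p
      using emb_d_flip P_closed[OF \<open>g \<in> P\<close>] P_closed[OF that] by metis
    then show ?thesis unfolding left_le_def right_le_def l_coset_def r_coset_def by blast
  qed
  ultimately show ?thesis using emb_X_left by blast
qed

lemma expression_lists:
  assumes "ts \<in> lists (emb ` X)"
  obtains xs where "xs \<in> lists X" "ts = map emb xs" "foldr (\<otimes>) ts \<one> = pr xs"
proof -
  obtain xs where "xs \<in> lists X" "ts = map emb xs" using assms by (auto simp: lists_image)
  then show ?thesis using that by (simp add: pr_def foldr_map comp_def)
qed

text \<open>Products of suffixes are right divisors of \<open>g\<close>. They are pairwise
  different, since two equal ones would make the block of letters between them trivial, and with it
  each letter. The number of right divisors is thus a bound.\<close>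

lemma expressions_bounded:
  assumes "g \<in> P"
  shows "\<exists>N. \<forall>ts\<in>lists (emb ` X - {\<one>}). foldr (\<otimes>) ts \<one> = g \<longrightarrow> length ts \<le> N"
proof (intro exI ballI impI)
  fix ts assume ts: "ts \<in> lists (emb ` X - {\<one>})" "foldr (\<otimes>) ts \<one> = g"
  then have "ts \<in> lists (emb ` X)" by (meson DiffE in_lists_conv_set)
  then obtain xs where xs: "xs \<in> lists X" "ts = map emb xs" "foldr (\<otimes>) ts \<one> = pr xs"
    by (rule expression_lists)
  have drop: "drop i xs \<in> lists X" "take i xs \<in> lists X" for i
    using xs(1) by (meson in_lists_conv_set in_set_dropD in_set_takeD)+
  have "pr (drop i xs) \<noteq> pr (drop j xs)" if ij: "i < j" "j \<le> length xs" for i j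
  proof
    assume eq: "pr (drop i xs) = pr (drop j xs)"
    define ys where "ys = take (j - i) (drop i xs)"
    have "drop i xs = ys @ drop j xs"
      using ij append_take_drop_id[of "j - i" "drop i xs"] by (simp add: ys_def)
    moreover have ys: "ys \<in> lists X" using drop(1)[of i] unfolding ys_def
      by (meson in_lists_conv_set in_set_takeD)
    ultimately have "pr ys \<otimes> pr (drop j xs) = pr (drop j xs)" using pr_append drop eq by metis
    then have "pr ys = \<one>" using ys drop pr_closed by (metis r_cancel_one)
    moreover have "ys \<noteq> []" using ij by (simp add: ys_def)
    ultimately have "emb (hd ys) = \<one>" using pr_eq_oneD ys by (meson hd_in_set)
    moreover have "hd ys \<in> set xs" using \<open>ys \<noteq> []\<close> unfolding ys_def
      by (meson hd_in_set in_set_dropD in_set_takeD)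
    ultimately show False using ts(1) xs(2) by auto
  qed
  then have inj: "inj_on (\<lambda>i. pr (drop i xs)) {..length xs}"
    by (intro linorder_inj_onI) auto
  have "(\<lambda>i. pr (drop i xs)) ` {..length xs} \<subseteq> {q \<in> P. \<exists>p\<in>P. g = p \<otimes> q}"
  proof (intro image_subsetI CollectI conjI)
    fix i
    show "pr (drop i xs) \<in> P" using drop pr_in_P by blast
    have "g = pr (take i xs) \<otimes> pr (drop i xs)" using xs(3) ts(2) pr_append drop by (metis append_take_drop_id)
    then show "\<exists>p\<in>P. g = p \<otimes> pr (drop i xs)" using drop pr_in_P by blast
  qed
  then have "card {..length xs} \<le> card {q \<in> P. \<exists>p\<in>P. g = p \<otimes> q}"
    using card_inj_on_le[OF inj] finite_right_divisors[OF assms] by blast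
  then show "length ts \<le> card {q \<in> P. \<exists>p\<in>P. g = p \<otimes> q}" using xs(2) by simp
qed

lemma garside_structure_emb: "garside_structure H (emb ` X) (emb d)"
  unfolding garside_structure_def Let_def generated_submonoid_P
proof (intro conjI)
  show "emb ` X = {g \<in> P. left_le H P \<one> g \<and> left_le H P g (emb d)}" by (rule emb_X_left)
  show "emb ` X = {g \<in> P. right_le H P \<one> g \<and> right_le H P g (emb d)}" by (rule emb_X_right)
  show "\<forall>g\<in>P. \<exists>N. \<forall>ts\<in>lists (emb ` X - {\<one>}). foldr (\<otimes>) ts \<one> = g \<longrightarrow> length ts \<le> N"
    using expressions_bounded by blast
qed (rule emb_generate lattice_left lattice_right emb_in_P[OF d_in])+

theorem garside_group_H: "garside_group H"
  unfolding garside_group_def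
  using is_group emb_d_closed emb_closed finite_imageI[OF finite_X] garside_structure_emb by blast

end

section \<open>Doubling a partial monoid; graphs of girth at least 5\<close>

datatype 'q doubled = Pos 'q | Cpl 'q

text \<open>\<open>Cpl v\<close> stands for \<open>v^-1 \<Delta>\<close>. The second clause is
  \<open>u v^-1 = w^-1\<close> for \<open>v = w u\<close>, the third is \<open>v^-1 u = w^-1\<close>
  for \<open>v = u w\<close>. Two complements would produce a second \<open>\<Delta>\<close>, so
  their product is undefined.\<close>

fun doubled_mult :: "('q \<Rightarrow> 'q \<Rightarrow> 'q \<Rightarrow> bool) \<Rightarrow> 'q doubled \<Rightarrow> 'q doubled \<Rightarrow> 'q doubled \<Rightarrow> bool" where
  "doubled_mult M (Pos u) (Pos v) (Pos w) = M u v w"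
| "doubled_mult M (Pos u) (Cpl v) (Cpl w) = M w u v"
| "doubled_mult M (Cpl v) (Pos u) (Cpl w) = M u w v"
| "doubled_mult M _ _ _ = False"

lemma doubled_mult_cases:
  assumes "doubled_mult M x y z"
  obtains u v w where "x = Pos u" "y = Pos v" "z = Pos w" "M u v w"
  | u v w where "x = Pos u" "y = Cpl v" "z = Cpl w" "M w u v"
  | u v w where "x = Cpl v" "y = Pos u" "z = Cpl w" "M u w v"
  using assms by (cases x; cases y; cases z) auto

text \<open>Cancellation is needed on both sides because multiplying a complement divides by a word:
  \<open>M_rcancel\<close> and \<open>M_lcancel\<close> become the well-definedness of the mixed
  products after doubling.\<close>

locale partial_monoid =
  fixes Q :: "'q set" and M :: "'q \<Rightarrow> 'q \<Rightarrow> 'q \<Rightarrow> bool" and e :: 'q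
  assumes finite_Q: "finite Q"
    and M_closed: "M x y z \<Longrightarrow> x \<in> Q \<and> y \<in> Q \<and> z \<in> Q"
    and M_fun: "M x y z \<Longrightarrow> M x y z' \<Longrightarrow> z = z'"
    and M_lcancel: "M x y z \<Longrightarrow> M x y' z \<Longrightarrow> y = y'"
    and M_rcancel: "M x y z \<Longrightarrow> M x' y z \<Longrightarrow> x = x'"
    and e_Q: "e \<in> Q"
    and M_e_left: "x \<in> Q \<Longrightarrow> M e x x"
    and M_e_right: "x \<in> Q \<Longrightarrow> M x e x"
    and M_assoc1: "M x y p \<Longrightarrow> M p z q \<Longrightarrow> \<exists>r. M y z r \<and> M x r q"
    and M_assoc2: "M y z r \<Longrightarrow> M x r q \<Longrightarrow> \<exists>p. M x y p \<and> M p z q"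
    and M_conical: "M x y e \<Longrightarrow> x = e"
begin

text \<open>At most one factor of a defined product is a complement; in each position of that
  factor, associativity turns into \<open>M_assoc1\<close> or \<open>M_assoc2\<close>. The
  complement of \<open>Pos u\<close> is \<open>Cpl u\<close> on either side. Only the bowtie axiom
  has to be supplied.\<close>

lemma germ_doubled:
  assumes bowtie: "\<And>p a x q b a' y b'. doubled_mult M p a x \<Longrightarrow> doubled_mult M q b x \<Longrightarrow>
      doubled_mult M p a' y \<Longrightarrow> doubled_mult M q b' y \<Longrightarrow>
      \<exists>t. (\<exists>c. doubled_mult M p c t) \<and> (\<exists>c. doubled_mult M q c t) \<and>
        (\<exists>c. doubled_mult M t c x) \<and> (\<exists>c. doubled_mult M t c y)"
  shows "germ (Pos ` Q \<union> Cpl ` Q) (doubled_mult M) (Pos e) (Cpl e)"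
proof
  show "finite (Pos ` Q \<union> Cpl ` Q)" using finite_Q by simp
  show "Pos e \<in> Pos ` Q \<union> Cpl ` Q" using e_Q by simp
  fix x y z z' y' p q r
  show "x \<in> Pos ` Q \<union> Cpl ` Q \<and> y \<in> Pos ` Q \<union> Cpl ` Q \<and> z \<in> Pos ` Q \<union> Cpl ` Q"
    if "doubled_mult M x y z"
    using that by (cases rule: doubled_mult_cases) (auto dest: M_closed)
  show "z = z'" if "doubled_mult M x y z" "doubled_mult M x y z'"
    using that(1) by (cases rule: doubled_mult_cases; use that(2) in
      \<open>auto elim!: doubled_mult_cases dest: M_fun M_lcancel M_rcancel\<close>)
  show "y = y'" if "doubled_mult M x y z" "doubled_mult M x y' z"
    using that(1) by (cases rule: doubled_mult_cases; use that(2) in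
      \<open>auto elim!: doubled_mult_cases dest: M_fun M_lcancel M_rcancel\<close>)
  show "doubled_mult M (Pos e) x x" if "x \<in> Pos ` Q \<union> Cpl ` Q"
    using that M_e_left M_e_right by auto
  show "doubled_mult M x (Pos e) x" if "x \<in> Pos ` Q \<union> Cpl ` Q"
    using that M_e_left M_e_right by auto
  show "\<exists>r. doubled_mult M y z r \<and> doubled_mult M x r q"
    if 1: "doubled_mult M x y p" and 2: "doubled_mult M p z q"
    using 1
  proof (cases rule: doubled_mult_cases)
    case 1: (1 u v w)
    show ?thesis using 2
    proof (cases rule: doubled_mult_cases)
      case i1: (1 u1 v1 w1)
      then obtain r where "M v v1 r" "M u r w1" using 1 M_assoc1 by blast
      then show ?thesis using 1 i1 by (intro exI[of _ "Pos r"]) auto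
    next
      case i2: (2 u1 v1 w1)
      then obtain r where "M w1 u r" "M r v v1" using 1 M_assoc2 by blast
      then show ?thesis using 1 i2 by (intro exI[of _ "Cpl r"]) auto
    qed (use 1 in auto)
  next
    case i2: (2 u v w)
    show ?thesis using 2
    proof (cases rule: doubled_mult_cases)
      case i3: (3 u1 v1 w1)
      then obtain r where "M w1 u r" "M u1 r v" using i2 M_assoc1 by blast
      then show ?thesis using i2 i3 by (intro exI[of _ "Cpl r"]) auto
    qed (use i2 in auto)
  next
    case 3: (3 u v w)
    show ?thesis using 2
    proof (cases rule: doubled_mult_cases)
      case i3: (3 u1 v1 w1)
      then obtain r where "M u u1 r" "M r w1 v" using 3 M_assoc2 by blast
      then show ?thesis using 3 i3 by (intro exI[of _ "Pos r"]) auto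
    qed (use 3 in auto)
  qed
  show "\<exists>p. doubled_mult M x y p \<and> doubled_mult M p z q"
    if 1: "doubled_mult M y z r" and 2: "doubled_mult M x r q"
    using 1
  proof (cases rule: doubled_mult_cases)
    case 1: (1 u v w)
    show ?thesis using 2
    proof (cases rule: doubled_mult_cases)
      case i1: (1 u1 v1 w1)
      then obtain p where "M u1 u p" "M p v w1" using 1 M_assoc2 by blast
      then show ?thesis using 1 i1 by (intro exI[of _ "Pos p"]) auto
    next
      case i3: (3 u1 v1 w1)
      then obtain p where "M v w1 p" "M u p v1" using 1 M_assoc1 by blast
      then show ?thesis using 1 i3 by (intro exI[of _ "Cpl p"]) auto
    qed (use 1 in auto)
  next
    case i2: (2 u v w)
    show ?thesis using 2
    proof (cases rule: doubled_mult_cases)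
      case 3: (2 u1 v1 w1)
      then obtain p where "M u1 u p" "M w1 p v" using i2 M_assoc1 by blast
      then show ?thesis using i2 3 by (intro exI[of _ "Pos p"]) auto
    qed (use i2 in auto)
  next
    case 3: (3 u v w)
    show ?thesis using 2
    proof (cases rule: doubled_mult_cases)
      case i3: (2 u1 v1 w1)
      then obtain p where "M u w1 p" "M p u1 v" using 3 M_assoc2 by blast
      then show ?thesis using 3 i3 by (intro exI[of _ "Cpl p"]) auto
    qed (use 3 in auto)
  qed
  show "x = Pos e" if "doubled_mult M x y (Pos e)"
    using that by (cases rule: doubled_mult_cases) (auto dest: M_conical)
  show "\<exists>y. doubled_mult M x y (Cpl e) \<and> doubled_mult M y x (Cpl e)"
    if x: "x \<in> Pos ` Q \<union> Cpl ` Q"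
    using x
  proof
    assume "x \<in> Pos ` Q"
    then obtain u where "u \<in> Q" "x = Pos u" by blast
    then show ?thesis using M_e_left M_e_right by (intro exI[of _ "Cpl u"]) auto
  next
    assume "x \<in> Cpl ` Q"
    then obtain u where "u \<in> Q" "x = Cpl u" by blast
    then show ?thesis using M_e_left M_e_right by (intro exI[of _ "Pos u"]) auto
  qed
qed (rule bowtie)

end

section \<open>Short circles in multigraphs\<close>

lemma girth_ge_5:
  assumes "5 \<le> girth \<Gamma>" "embedded_circle \<Gamma> vs es"
  shows "5 \<le> length es"
proof -
  have "girth \<Gamma> \<le> enat (length es)"
    unfolding girth_def by (rule Inf_lower) (use assms in blast)
  then have "5 \<le> enat (length es)" using assms(1) by (rule order_trans[rotated])
  then show ?thesis by (simp add: numeral_eq_enat)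
qed

definition adjacent :: "('v, 'e) multigraph \<Rightarrow> 'e \<Rightarrow> 'v \<Rightarrow> 'v \<Rightarrow> bool" where
  "adjacent \<Gamma> f a b \<longleftrightarrow> f \<in> edges \<Gamma> \<and> ends \<Gamma> f = {a, b} \<and> {a, b} \<subseteq> verts \<Gamma>"

lemma adjacent_sym: "adjacent \<Gamma> f a b \<longleftrightarrow> adjacent \<Gamma> f b a"
  by (auto simp: adjacent_def)

lemma no_bigon:
  assumes "5 \<le> girth \<Gamma>" "adjacent \<Gamma> f a b" "adjacent \<Gamma> f' a b" "a \<noteq> b"
  shows "f = f'"
proof (rule ccontr)
  assume "f \<noteq> f'"
  then have "embedded_circle \<Gamma> [a, b] [f, f']"
    using assms unfolding embedded_circle_def adjacent_def by (auto simp: less_Suc_eq)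
  from girth_ge_5[OF assms(1) this] show False by simp
qed

lemma no_triangle:
  assumes "5 \<le> girth \<Gamma>" "adjacent \<Gamma> f a b" "adjacent \<Gamma> g b c" "adjacent \<Gamma> h c a"
    and "a \<noteq> b" "b \<noteq> c" "c \<noteq> a"
  shows False
proof -
  have "f \<noteq> g" "g \<noteq> h" "f \<noteq> h"
    using assms unfolding adjacent_def by (auto simp: doubleton_eq_iff)
  then have "embedded_circle \<Gamma> [a, b, c] [f, g, h]"
    using assms unfolding embedded_circle_def adjacent_def by (auto simp: less_Suc_eq)
  from girth_ge_5[OF assms(1) this] show False by simp
qed

lemma no_square:
  assumes "5 \<le> girth \<Gamma>" "adjacent \<Gamma> f a b" "adjacent \<Gamma> g b c" "adjacent \<Gamma> h c d" "adjacent \<Gamma> k d a"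
    and "distinct [a, b, c, d]"
  shows False
proof -
  have "distinct [f, g, h, k]"
    using assms unfolding adjacent_def by (auto simp: doubleton_eq_iff)
  then have "embedded_circle \<Gamma> [a, b, c, d] [f, g, h, k]"
    using assms unfolding embedded_circle_def adjacent_def by (auto simp: less_Suc_eq)
  from girth_ge_5[OF assms(1) this] show False by simp
qed

lemma nth_concat_pairs:
  "i < length R \<Longrightarrow> concat (map (\<lambda>(r, r'). [r, r']) R) ! (2 * i) = fst (R ! i) \<and>
    concat (map (\<lambda>(r, r'). [r, r']) R) ! Suc (2 * i) = snd (R ! i)"
proof (induction R arbitrary: i)
  case (Cons p R)
  then show ?case by (cases i) (auto split: prod.splits)
qed simp

lemma length_concat_pairs: "length (concat (map (\<lambda>(r, r'). [r, r']) R)) = 2 * length R"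
  by (induction R) (auto split: prod.splits)

locale t5_presentation =
  fixes S :: "'a set" and R :: "('a list \<times> 'a list) list"
  assumes finite_S: "finite S"
    and R_lists: "set R \<subseteq> lists S \<times> lists S"
    and no_prefix: "\<And>r r' p. (r, r') \<in> set R \<Longrightarrow> p \<noteq> [] \<Longrightarrow> \<not> (prefix p r \<and> prefix p r')"
    and no_suffix: "\<And>r r' p. (r, r') \<in> set R \<Longrightarrow> p \<noteq> [] \<Longrightarrow> \<not> (suffix p r \<and> suffix p r')"
    and no_sublist: "\<And>ws i j. ws = concat (map (\<lambda>(r, r'). [r, r']) R) \<Longrightarrow>
           i < length ws \<Longrightarrow> j < length ws \<Longrightarrow> i \<noteq> j \<Longrightarrow> \<not> sublist (ws ! i) (ws ! j)"
    and first_letters: "\<And>s t. s \<in> S \<Longrightarrow> t \<in> S \<Longrightarrow> s \<noteq> t \<Longrightarrow>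
           \<exists>\<^sub>\<le>\<^sub>1 i. i < length R \<and> {hd (fst (R ! i)), hd (snd (R ! i))} = {s, t}"
    and last_letters: "\<And>s t. s \<in> S \<Longrightarrow> t \<in> S \<Longrightarrow> s \<noteq> t \<Longrightarrow>
           \<exists>\<^sub>\<le>\<^sub>1 i. i < length R \<and> {last (fst (R ! i)), last (snd (R ! i))} = {s, t}"
    and girth: "girth (presentation_link S R) \<ge> 5"
begin

section \<open>Subwords of relators as a partial monoid\<close>

definition relators :: "'a list set" where
  "relators = fst ` set R \<union> snd ` set R"

text \<open>Words of length at most 1 are added explicitly, so that generators occurring in no
  relator, and the empty word, are present.\<close>

definition W :: "'a list set" where
  "W = {w \<in> lists S. length w \<le> 1 \<or> (\<exists>r\<in>relators. sublist w r)}"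

text \<open>Both sides of a relation are one group element, named by the first side. The choice is
  unambiguous: no word is the second side of relations with different first sides.\<close>

definition rep :: "'a list \<Rightarrow> 'a list" where
  "rep w = (if w \<in> snd ` set R then SOME r. (r, w) \<in> set R else w)"

definition Q :: "'a list set" where
  "Q = W - snd ` set R"

definition M :: "'a list \<Rightarrow> 'a list \<Rightarrow> 'a list \<Rightarrow> bool" where
  "M u v w \<longleftrightarrow> u \<in> Q \<and> v \<in> Q \<and> u @ v \<in> W \<and> w = rep (u @ v)"

definition side :: "nat \<Rightarrow> bool \<Rightarrow> 'a list" where
  "side i b = (if b then fst (R ! i) else snd (R ! i))"

text \<open>In the interleaved list, side \<open>b\<close> of relation \<open>i\<close> sits at
  index \<open>2 * i\<close> or \<open>Suc (2 * i)\<close>, so the subword condition separates all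
  the sides, including the two of one relation.\<close>

lemma side_inj:
  assumes "i < length R" "j < length R" "sublist (side i b) (side j c)"
  shows "i = j \<and> b = c"
proof -
  define ws where "ws = concat (map (\<lambda>(r, r'). [r, r']) R)"
  define n where "n i b = (if b then 2 * i else Suc (2 * i))" for i b
  have n: "n i b < length ws" "ws ! n i b = side i b" if "i < length R" for i b
    using that nth_concat_pairs[OF that] length_concat_pairs[of R]
    by (auto simp: ws_def n_def side_def)
  have "n i b = n j c"
    using no_sublist[OF ws_def, of "n i b" "n j c"] n assms by auto
  then show ?thesis by (cases b; cases c; simp add: n_def) presburger+
qed

lemma relators_side: "relators = {side i b |i b. i < length R}"
proof -
  have "set R = (!) R ` {..<length R}" by (auto simp: set_conv_nth)
  then have "relators = (\<lambda>i. side i True) ` {..<length R} \<union> (\<lambda>i. side i False) ` {..<length R}"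
    by (simp add: relators_def side_def image_image)
  also have "\<dots> = {side i b |i b. i < length R}"
  proof
    show "{side i b |i b. i < length R} \<subseteq> (\<lambda>i. side i True) ` {..<length R} \<union> (\<lambda>i. side i False) ` {..<length R}"
    proof
      fix x assume "x \<in> {side i b |i b. i < length R}"
      then obtain i b where "i < length R" "x = side i b" by blast
      then show "x \<in> (\<lambda>i. side i True) ` {..<length R} \<union> (\<lambda>i. side i False) ` {..<length R}"
        by (cases b) auto
    qed
  qed blast
  finally show ?thesis .
qed

lemma relation_side:
  "(r, r') \<in> set R \<longleftrightarrow> (\<exists>i<length R. r = side i True \<and> r' = side i False)"
  unfolding side_def by (auto simp: in_set_conv_nth)

lemma relators_sublist:
  assumes "r \<in> relators" "r' \<in> relators" "sublist r r'"
  shows "r = r'"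
  using assms side_inj unfolding relators_side by blast

lemma relation_relators: "(r, r') \<in> set R \<Longrightarrow> r \<in> relators \<and> r' \<in> relators"
  unfolding relators_def by force

lemma fst_snd_disjoint: "(r, r') \<in> set R \<Longrightarrow> r \<notin> snd ` set R"
proof
  assume "(r, r') \<in> set R" "r \<in> snd ` set R"
  then obtain q where "(r, r') \<in> set R" "(q, r) \<in> set R" by auto
  then obtain i j where "i < length R" "j < length R" "r = side i True" "r = side j False"
    unfolding relation_side by blast
  then show False using side_inj[of i j True False] by auto
qed

lemma relation_unique: "(r, r') \<in> set R \<Longrightarrow> (q, r') \<in> set R \<Longrightarrow> q = r"
  unfolding relation_side using side_inj by (metis sublist_order.order_refl)

lemma relation_unique': "(r, x) \<in> set R \<Longrightarrow> (r, y) \<in> set R \<Longrightarrow> x = y"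
  unfolding relation_side using side_inj by (metis sublist_order.order_refl)

text \<open>An empty side would be a subword of the other side of its relation.\<close>

lemma relators_nonempty: "r \<in> relators \<Longrightarrow> r \<noteq> []"
proof
  assume "r \<in> relators" "r = []"
  then obtain i b where i: "i < length R" "r = side i b" unfolding relators_side by blast
  with \<open>r = []\<close> have "sublist (side i b) (side i (\<not> b))" by (metis sublist_Nil_left)
  then show False using side_inj[of i i b "\<not> b"] i by auto
qed

lemma relators_lists: "r \<in> relators \<Longrightarrow> r \<in> lists S"
  using R_lists unfolding relators_def by force

lemma hd_neq:
  assumes "(r, r') \<in> set R"
  shows "hd r \<noteq> hd r'"
proof
  assume eq: "hd r = hd r'"
  have "r \<noteq> []" "r' \<noteq> []" using relation_relators[OF assms] relators_nonempty by auto
  then have "prefix [hd r] r \<and> prefix [hd r] r'" using eq by (cases r; cases r') auto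
  then show False using no_prefix[OF assms, of "[hd r]"] by simp
qed

lemma last_neq:
  assumes "(r, r') \<in> set R"
  shows "last r \<noteq> last r'"
proof
  assume eq: "last r = last r'"
  have "r \<noteq> []" "r' \<noteq> []" using relation_relators[OF assms] relators_nonempty by auto
  then have "suffix [last r] r \<and> suffix [last r] r'"
    using eq by (metis append_butlast_last_id suffixI)
  then show False using no_suffix[OF assms, of "[last r]"] by simp
qed

lemma W_lists: "w \<in> W \<Longrightarrow> w \<in> lists S"
  unfolding W_def by blast

lemma relators_W: "r \<in> relators \<Longrightarrow> r \<in> W"
  unfolding W_def using relators_lists by auto

lemma W_sublist:
  assumes "w \<in> W" "sublist v w"
  shows "v \<in> W"
proof -
  have "set v \<subseteq> set w" "length v \<le> length w"
    using assms(2) set_mono_sublist sublist_length_le by blast+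
  then show ?thesis using assms sublist_order.order_trans[of v w]
    unfolding W_def by (auto simp: in_lists_conv_set)
qed

lemma W_append: "u @ v \<in> W \<Longrightarrow> u \<in> W \<and> v \<in> W"
  using W_sublist by (metis sublist_append_rightI sublist_append_leftI)

lemma relators_W_sublist:
  assumes "r \<in> relators" "w \<in> W" "sublist r w"
  shows "r = w"
proof (cases "length w \<le> 1")
  case True
  have "length r > 0" using relators_nonempty assms(1) by simp
  moreover have "length r \<le> length w" using assms(3) sublist_length_le by blast
  ultimately have "length r = length w" using True by linarith
  then show ?thesis using assms(3) unfolding sublist_def by auto
next
  case False
  then obtain r' where r': "r' \<in> relators" "sublist w r'" using assms(2) unfolding W_def by blast
  then have "r = r'" using relators_sublist assms sublist_order.order_trans by blast
  then show ?thesis using r'(2) assms(3) sublist_order.order_antisym by blast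
qed

text \<open>A relator is maximal in \<open>W\<close>, so it has no nontrivial products there.
  Replacing one side of a relation by the other thus neither creates nor destroys a product.\<close>

lemma relators_W_append:
  assumes "u @ v \<in> W"
  shows "u \<in> relators \<Longrightarrow> v = []" "v \<in> relators \<Longrightarrow> u = []"
  using relators_W_sublist[OF _ assms] by fastforce+

lemma rep_fst: "(r, r') \<in> set R \<Longrightarrow> rep r = r"
  using fst_snd_disjoint by (simp add: rep_def)

lemma rep_snd: "(r, r') \<in> set R \<Longrightarrow> rep r' = r"
proof -
  assume *: "(r, r') \<in> set R"
  then have "r' \<in> snd ` set R" by force
  then show ?thesis using * relation_unique unfolding rep_def
    by (metis (mono_tags, lifting) someI_ex)
qed

lemma rep_cases:
  obtains "rep w = w" "w \<notin> snd ` set R" | r where "(r, w) \<in> set R" "rep w = r"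
  using rep_snd[of _ w] unfolding rep_def by (metis imageE prod.collapse)

lemma rep_Q: "w \<in> W \<Longrightarrow> rep w \<in> Q"
  by (rule rep_cases[of w])
    (auto simp: Q_def fst_snd_disjoint dest: relation_relators relators_W)

lemma rep_id: "w \<in> Q \<Longrightarrow> rep w = w"
  by (simp add: Q_def rep_def)

lemma rep_nonrelator: "w \<notin> relators \<Longrightarrow> rep w = w"
  by (auto simp: relators_def rep_def)

lemma rep_relators: "w \<in> relators \<Longrightarrow> rep w \<in> relators"
  by (rule rep_cases[of w]) (auto dest: relation_relators)

lemma rep_eqD:
  assumes "rep x = rep y"
  shows "x = y \<or> (x, y) \<in> set R \<or> (y, x) \<in> set R"
  using assms relation_unique' by (cases rule: rep_cases[of x]; cases rule: rep_cases[of y]) auto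

lemma Q_W: "w \<in> Q \<Longrightarrow> w \<in> W"
  by (simp add: Q_def)

lemma Nil_Q: "[] \<in> Q"
  using relators_nonempty unfolding Q_def W_def relators_def by force

text \<open>Products may be formed on words before passing to representatives: if both factors are
  nonempty, neither is a relator and \<open>rep\<close> fixes both.\<close>

lemma M_append: "u @ v \<in> W \<Longrightarrow> M (rep u) (rep v) (rep (u @ v))"
proof -
  assume uv: "u @ v \<in> W"
  then have Q: "rep u \<in> Q" "rep v \<in> Q" using rep_Q W_append by blast+
  consider "u = []" | "v = []" | "u \<notin> relators" "v \<notin> relators"
    using relators_W_append[OF uv] by blast
  then show ?thesis
  proof cases
    case 3
    then show ?thesis using rep_nonrelator Q uv by (simp add: M_def)
  qed (use Q Q_W rep_id Nil_Q in \<open>auto simp: M_def\<close>)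
qed

lemma finite_W: "finite W"
proof -
  have "w \<in> {[]} \<union> (\<lambda>s. [s]) ` S \<union> (\<Union>r\<in>relators. set (sublists r))" if "w \<in> W" for w
  proof -
    have "w \<in> lists S" "length w \<le> 1 \<or> (\<exists>r\<in>relators. sublist w r)" using that W_def by auto
    then show ?thesis by (cases w rule: remdups_adj.cases) (auto simp: set_sublists_eq)
  qed
  then have "W \<subseteq> {[]} \<union> (\<lambda>s. [s]) ` S \<union> (\<Union>r\<in>relators. set (sublists r))" by blast
  moreover have "finite ({[]} \<union> (\<lambda>s. [s]) ` S \<union> (\<Union>r\<in>relators. set (sublists r)))"
    using finite_S by (auto simp: relators_def)
  ultimately show ?thesis by (rule finite_subset)
qed

lemma M_Nil: "x \<in> Q \<Longrightarrow> M [] x x" "x \<in> Q \<Longrightarrow> M x [] x"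
  using Nil_Q Q_W rep_id by (auto simp: M_def)

sublocale partial_monoid Q M "[]"
proof
  show "finite Q" using finite_W by (simp add: Q_def)
  show "[] \<in> Q" by (rule Nil_Q)
  fix x y z z' y' x' p q r
  show "M [] x x" "M x [] x" if "x \<in> Q" using M_Nil that by auto
  show "x \<in> Q \<and> y \<in> Q \<and> z \<in> Q" if "M x y z" using that rep_Q by (auto simp: M_def)
  show "z = z'" if "M x y z" "M x y z'" using that by (auto simp: M_def)
  show "y = y'" if *: "M x y z" "M x y' z"
  proof (cases "x = []")
    case True
    then show ?thesis using * rep_id by (auto simp: M_def)
  next
    case False
    \<comment> \<open>Either the words agree, or they are the two sides of a relation with common
      prefix \<open>x\<close>.\<close>
    have "x @ y = x @ y' \<or> (x @ y, x @ y') \<in> set R \<or> (x @ y', x @ y) \<in> set R"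
      using * by (intro rep_eqD) (simp add: M_def)
    then show ?thesis using no_prefix[OF _ False] by fastforce
  qed
  show "x = x'" if *: "M x y z" "M x' y z"
  proof (cases "y = []")
    case True
    then show ?thesis using * rep_id by (auto simp: M_def)
  next
    case False
    have "x @ y = x' @ y \<or> (x @ y, x' @ y) \<in> set R \<or> (x' @ y, x @ y) \<in> set R"
      using * by (intro rep_eqD) (simp add: M_def)
    then show ?thesis using no_suffix[OF _ False] by (fastforce simp: suffix_def)
  qed
  show "x = []" if *: "M x y []"
  proof -
    have "rep (x @ y) = rep []" using * rep_id Nil_Q by (simp add: M_def)
    then have "x @ y = []" using rep_eqD relation_relators relators_nonempty by blast
    then show ?thesis by simp
  qed
  show "\<exists>r. M y z r \<and> M x r q" if *: "M x y p" "M p z q"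
  proof -
    have Q: "x \<in> Q" "y \<in> Q" "z \<in> Q" "x @ y \<in> W" "p = rep (x @ y)" "rep (x @ y) @ z \<in> W"
      "q = rep (rep (x @ y) @ z)" using * by (auto simp: M_def)
    consider "x @ y = []" | "z = []" | "x @ y \<noteq> []" "z \<noteq> []" by blast
    then show ?thesis
    proof cases
      case 3
      \<comment> \<open>A word that can be extended by a nonempty \<open>z\<close> is no relator, so
        \<open>rep\<close> fixes it and only concatenation of words remains.\<close>
      then have "rep (x @ y) \<notin> relators" using Q(6) relators_W_append by blast
      then have "rep (x @ y) = x @ y" using rep_relators rep_nonrelator by blast
      then have "x @ (y @ z) \<in> W" "q = rep (x @ (y @ z))" using Q by auto
      then have "M (rep x) (rep (y @ z)) q" "M (rep y) (rep z) (rep (y @ z))"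
        using M_append W_append by blast+
      then show ?thesis using Q rep_id by auto
    qed (use * Q rep_id M_Nil in \<open>auto simp: M_def\<close>)
  qed
  show "\<exists>p. M x y p \<and> M p z q" if *: "M y z r" "M x r q"
  proof -
    have Q: "x \<in> Q" "y \<in> Q" "z \<in> Q" "y @ z \<in> W" "r = rep (y @ z)" "x @ rep (y @ z) \<in> W"
      "q = rep (x @ rep (y @ z))" using * by (auto simp: M_def)
    consider "y @ z = []" | "x = []" | "y @ z \<noteq> []" "x \<noteq> []" by blast
    then show ?thesis
    proof cases
      case 3
      then have "rep (y @ z) \<notin> relators" using Q(6) relators_W_append by blast
      then have "rep (y @ z) = y @ z" using rep_relators rep_nonrelator by blast
      then have "(x @ y) @ z \<in> W" "q = rep ((x @ y) @ z)" using Q by auto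
      then have "M (rep (x @ y)) (rep z) q" "M (rep x) (rep y) (rep (x @ y))"
        using M_append W_append by blast+
      then show ?thesis using Q rep_id by auto
    qed (use * Q rep_id M_Nil in \<open>auto simp: M_def\<close>)
  qed
qed

section \<open>Corners of the 2-cells as edges of the link\<close>

lemma attaching_word_nth:
  assumes "i < length R"
  shows "length (attaching_word (R ! i)) = length (side i True) + length (side i False)"
    and "k < length (side i True) \<Longrightarrow> attaching_word (R ! i) ! k = Gen (side i True ! k)"
    and "k < length (side i False) \<Longrightarrow> attaching_word (R ! i) ! (length (side i True) + k) =
      Inv (side i False ! (length (side i False) - Suc k))"
  by (auto simp: attaching_word_def inverse_word_def side_def nth_append rev_nth)

lemma side_relators: "i < length R \<Longrightarrow> side i b \<in> relators"
  unfolding relators_side by blast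

lemma side_nonempty: "i < length R \<Longrightarrow> side i b \<noteq> []"
  using side_relators relators_nonempty by blast

lemma side_nth_S: "i < length R \<Longrightarrow> j < length (side i b) \<Longrightarrow> side i b ! j \<in> S"
  using side_relators relators_lists by (metis in_lists_conv_set nth_mem)

text \<open>The second side of a relation is read backwards in the attaching word, as inverse letters.\<close>

definition corner :: "nat \<Rightarrow> bool \<Rightarrow> nat \<Rightarrow> nat \<times> nat" where
  "corner i b j = (i, if b then j else length (side i True) + (length (side i False) - Suc (Suc j)))"

lemma corner_adjacent:
  assumes "i < length R" "Suc j < length (side i b)"
  shows "adjacent (presentation_link S R) (corner i b j)
    (Incoming (side i b ! j)) (Outgoing (side i b ! Suc j))"
proof -
  have S: "side i b ! j \<in> S" "side i b ! Suc j \<in> S" using side_nth_S assms by auto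
  show ?thesis
  proof (cases b)
    case True
    then show ?thesis using assms S attaching_word_nth[OF assms(1)]
      by (simp add: adjacent_def presentation_link_def corner_def Let_def)
  next
    case False
    \<comment> \<open>Reversal puts letter \<open>Suc j\<close> before letter \<open>j\<close>, at
      positions \<open>k\<close> and \<open>Suc k\<close> of the inverted side. The successor index
      stays inside the word, so \<open>mod\<close> does not wrap around.\<close>
    define k where "k = length (side i False) - Suc (Suc j)"
    have k: "Suc k < length (side i False)" "length (side i False) - Suc k = Suc j"
      "length (side i False) - Suc (Suc k) = j" using assms False by (auto simp: k_def)
    then have "Suc (length (side i True) + k) mod (length (side i True) + length (side i False))
      = length (side i True) + Suc k" by simp
    moreover have "attaching_word (R ! i) ! (length (side i True) + k) = Inv (side i False ! Suc j)"
      "attaching_word (R ! i) ! (length (side i True) + Suc k) = Inv (side i False ! j)"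
      using attaching_word_nth(3)[OF assms(1), of k] attaching_word_nth(3)[OF assms(1), of "Suc k"] k
      by simp_all
    ultimately show ?thesis
      using False assms S k attaching_word_nth(1)[OF assms(1)]
      by (auto simp: adjacent_def presentation_link_def corner_def Let_def k_def[symmetric])
  qed
qed

lemma corner_inj:
  assumes "corner i b j = corner i' b' j'" "Suc j < length (side i b)" "Suc j' < length (side i' b')"
  shows "i = i' \<and> b = b' \<and> j = j'"
  using assms by (cases b; cases b') (auto simp: corner_def)

text \<open>The wrap-around corner, from the final letter \<open>Inv (hd r')\<close> of the
  attaching word to its initial letter \<open>Gen (hd r)\<close>: both ends are outgoing.\<close>

lemma first_adjacent:
  assumes "(r, r') \<in> set R"
  shows "\<exists>f. adjacent (presentation_link S R) f (Outgoing (hd r)) (Outgoing (hd r'))"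
proof -
  obtain i where i: "i < length R" "r = side i True" "r' = side i False"
    using assms relation_side by blast
  note ne = side_nonempty[OF i(1), of True] side_nonempty[OF i(1), of False]
  define n where "n = length r + (length r' - 1)"
  have n: "Suc n = length r + length r'" using ne i by (cases r') (auto simp: n_def)
  have "attaching_word (R ! i) ! n = Inv (hd r')" "attaching_word (R ! i) ! 0 = Gen (hd r)"
    using attaching_word_nth(3)[OF i(1), of "length r' - 1"] attaching_word_nth(2)[OF i(1), of 0] ne i
    by (simp_all add: n_def hd_conv_nth)
  moreover have "hd r \<in> S" "hd r' \<in> S" using side_nth_S[OF i(1), of 0] ne i by (auto simp: hd_conv_nth)
  ultimately have "adjacent (presentation_link S R) (i, n) (Outgoing (hd r)) (Outgoing (hd r'))"
    using attaching_word_nth(1)[OF i(1)] n i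
    by (auto simp: adjacent_def presentation_link_def Let_def)
  then show ?thesis by blast
qed

text \<open>The corner where \<open>r\<close> ends and the inverse of \<open>r'\<close> begins: both
  ends are incoming.\<close>

lemma last_adjacent:
  assumes "(r, r') \<in> set R"
  shows "\<exists>f. adjacent (presentation_link S R) f (Incoming (last r)) (Incoming (last r'))"
proof -
  obtain i where i: "i < length R" "r = side i True" "r' = side i False"
    using assms relation_side by blast
  note ne = side_nonempty[OF i(1), of True] side_nonempty[OF i(1), of False]
  define n where "n = length r - 1"
  have n: "Suc n = length r" "length r' > 0" using ne i by (auto simp: n_def)
  have "attaching_word (R ! i) ! n = Gen (last r)" "attaching_word (R ! i) ! (Suc n) = Inv (last r')"
    using attaching_word_nth(3)[OF i(1), of 0] attaching_word_nth(2)[OF i(1), of n] ne i n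
    by (simp_all add: n_def last_conv_nth)
  moreover have "last r \<in> S" "last r' \<in> S"
    using last_in_set[OF ne(1)] last_in_set[OF ne(2)] relators_lists[OF side_relators[OF i(1), of True]]
      relators_lists[OF side_relators[OF i(1), of False]] i by (auto simp: in_lists_conv_set)
  moreover have "Suc n mod (length r + length r') = Suc n" using n by simp
  ultimately have "adjacent (presentation_link S R) (i, n) (Incoming (last r)) (Incoming (last r'))"
    using attaching_word_nth(1)[OF i(1)] n i
    by (auto simp: adjacent_def presentation_link_def Let_def)
  then show ?thesis by blast
qed

lemma W_location:
  assumes "v @ u \<in> W" "v \<noteq> []" "u \<noteq> []"
  obtains i b p q where "i < length R" "side i b = p @ v @ u @ q"
proof -
  have "\<not> length (v @ u) \<le> 1" using assms(2,3) by (cases v; cases u) auto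
  then obtain r where r: "r \<in> relators" "sublist (v @ u) r" using assms(1) W_def by blast
  then obtain p q where "r = p @ (v @ u) @ q" unfolding sublist_def by blast
  moreover obtain i b where "i < length R" "r = side i b" using r(1) relators_side by blast
  ultimately show ?thesis using that by simp
qed

lemma location_nth:
  assumes "side i b = p @ v @ u @ q" "v \<noteq> []" "u \<noteq> []"
  defines "j \<equiv> length p + length v - 1"
  shows "Suc j < length (side i b)" "side i b ! j = last v" "side i b ! Suc j = hd u"
proof -
  have lens: "length v > 0" "length u > 0" using assms by auto
  then show "Suc j < length (side i b)" using assms(1) by (simp add: j_def)
  have j: "j = length p + (length v - 1)" "Suc j = length p + (length v + 0)" using assms(2) by (cases v; simp add: j_def)+
  show "side i b ! j = last v"
    unfolding assms(1) j(1) nth_append_length_plus using assms(2) lens by (simp add: nth_append last_conv_nth)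
  show "side i b ! Suc j = hd u"
    unfolding assms(1) j(2) nth_append_length_plus using assms(3) lens by (simp add: nth_append hd_conv_nth)
qed

lemma W_adjacent:
  assumes "v @ u \<in> W" "v \<noteq> []" "u \<noteq> []"
  shows "\<exists>f. adjacent (presentation_link S R) f (Incoming (last v)) (Outgoing (hd u))"
  using W_location[OF assms] location_nth[OF _ assms(2,3)] corner_adjacent by metis

text \<open>The two factorisations give parallel edges of the link. Without bigons these are one
  corner, so both words are read around the same place of the same relator and can be compared
  there.\<close>

lemma W_overlap:
  assumes "v @ u \<in> W" "v \<noteq> []" "u \<noteq> []" "v' @ u' \<in> W" "v' \<noteq> []" "u' \<noteq> []"
    and "last v = last v'" "hd u = hd u'"
  shows "(suffix v v' \<or> suffix v' v) \<and> (prefix u u' \<or> prefix u' u)"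
proof -
  obtain i b p q where 1: "i < length R" "side i b = p @ v @ u @ q" by (rule W_location[OF assms(1-3)])
  obtain i' b' p' q' where 2: "i' < length R" "side i' b' = p' @ v' @ u' @ q'"
    by (rule W_location[OF assms(4-6)])
  note l1 = location_nth[OF 1(2) assms(2,3)] and l2 = location_nth[OF 2(2) assms(5,6)]
  have "corner i b (length p + length v - 1) = corner i' b' (length p' + length v' - 1)"
    by (rule no_bigon[OF girth corner_adjacent[OF 1(1) l1(1)]])
      (use corner_adjacent[OF 2(1) l2(1)] l1 l2 assms(7,8) in auto)
  then have eq: "i = i'" "b = b'" "length p + length v - 1 = length p' + length v' - 1"
    using corner_inj[OF _ l1(1) l2(1)] by auto
  then have "length (p @ v) = length (p' @ v')" using l1(1) l2(1) assms(2,5) by (cases v; cases v') auto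
  moreover have "(p @ v) @ u @ q = (p' @ v') @ u' @ q'" using 1(2) 2(2) eq by simp
  ultimately have pv: "p @ v = p' @ v'" "u @ q = u' @ q'" using append_eq_append_conv by blast+
  have "suffix v (p @ v)" "suffix v' (p @ v)" unfolding pv(1) by (metis pv(1) suffixI)+
  moreover have "prefix u (u @ q)" "prefix u' (u @ q)" unfolding pv(2) by (metis pv(2) prefixI)+
  ultimately show ?thesis using suffix_same_cases prefix_same_cases by metis
qed

text \<open>The vertices \<open>Outgoing (hd u)\<close> and \<open>Outgoing (hd u')\<close> are
  joined by the corner at the beginning of the relation, and each is joined to
  \<open>Incoming (last v)\<close>: a triangle.\<close>

lemma no_triangle_first:
  assumes "(r, r') \<in> set R" "v \<noteq> []" "u \<noteq> []" "u' \<noteq> []" "v @ u \<in> W" "v @ u' \<in> W"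
    and "{hd u, hd u'} = {hd r, hd r'}"
  shows False
proof -
  obtain f where f: "adjacent (presentation_link S R) f (Outgoing (hd u)) (Outgoing (hd u'))"
    using first_adjacent[OF assms(1)] assms(7) adjacent_sym by (metis doubleton_eq_iff)
  obtain g where g: "adjacent (presentation_link S R) g (Incoming (last v)) (Outgoing (hd u))"
    using W_adjacent assms by blast
  obtain h where h: "adjacent (presentation_link S R) h (Incoming (last v)) (Outgoing (hd u'))"
    using W_adjacent assms by blast
  have "hd u \<noteq> hd u'" using hd_neq[OF assms(1)] assms(7) by (metis doubleton_eq_iff)
  then show False
    using no_triangle[OF girth g f] h adjacent_sym by fastforce
qed

lemma no_triangle_last:
  assumes "(r, r') \<in> set R" "v \<noteq> []" "v' \<noteq> []" "u \<noteq> []" "v @ u \<in> W" "v' @ u \<in> W"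
    and "{last v, last v'} = {last r, last r'}"
  shows False
proof -
  obtain f where f: "adjacent (presentation_link S R) f (Incoming (last v)) (Incoming (last v'))"
    using last_adjacent[OF assms(1)] assms(7) adjacent_sym by (metis doubleton_eq_iff)
  obtain g where g: "adjacent (presentation_link S R) g (Incoming (last v)) (Outgoing (hd u))"
    using W_adjacent assms by blast
  obtain h where h: "adjacent (presentation_link S R) h (Incoming (last v')) (Outgoing (hd u))"
    using W_adjacent assms by blast
  have "last v \<noteq> last v'" using last_neq[OF assms(1)] assms(7) by (metis doubleton_eq_iff)
  then show False
    using no_triangle[OF girth f h] g adjacent_sym by fastforce
qed

text \<open>The four products are the edges of a square in the link. It is degenerate only if two
  last letters or two first letters agree, and then \<open>W_overlap\<close> makes the words
  comparable.\<close>

lemma no_square_W: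
  assumes "v @ u \<in> W" "v @ u' \<in> W" "v' @ u \<in> W" "v' @ u' \<in> W"
    and "v \<noteq> []" "v' \<noteq> []" "u \<noteq> []" "u' \<noteq> []"
  shows "(suffix v v' \<or> suffix v' v) \<or> (prefix u u' \<or> prefix u' u)"
proof (rule ccontr)
  assume neg: "\<not> ?thesis"
  then have "last v \<noteq> last v'" "hd u \<noteq> hd u'"
    using W_overlap[of v u v' u] W_overlap[of v u v u'] assms by blast+
  moreover obtain f g h k where
    "adjacent (presentation_link S R) f (Incoming (last v)) (Outgoing (hd u))"
    "adjacent (presentation_link S R) g (Incoming (last v')) (Outgoing (hd u))"
    "adjacent (presentation_link S R) h (Incoming (last v')) (Outgoing (hd u'))"
    "adjacent (presentation_link S R) k (Incoming (last v)) (Outgoing (hd u'))"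
    using W_adjacent assms by metis
  ultimately show False
    using no_square[OF girth, of f "Incoming (last v)" "Outgoing (hd u)" g "Incoming (last v')" h "Outgoing (hd u')" k]
      adjacent_sym by fastforce
qed

end

section \<open>Bowties in the doubled germ\<close>

lemma ex_doubled: "(\<exists>y. A y) \<longleftrightarrow> (\<exists>u. A (Pos u)) \<or> (\<exists>u. A (Cpl u))"
  by (metis doubled.exhaust)

context t5_presentation
begin

lemma prefix_M:
  assumes "u \<in> Q" "u' \<in> Q" "prefix u u'"
  shows "\<exists>c. M u c u'"
proof -
  obtain c where c: "u' = u @ c" using assms(3) by (auto simp: prefix_def)
  have W: "u @ c \<in> W" using assms(2) c Q_W by simp
  then have "M (rep u) (rep c) (rep (u @ c))" by (rule M_append)
  then show ?thesis using assms c rep_id by auto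
qed

lemma suffix_M:
  assumes "u \<in> Q" "u' \<in> Q" "suffix u u'"
  shows "\<exists>c. M c u u'"
proof -
  obtain c where c: "u' = c @ u" using assms(3) by (auto simp: suffix_def)
  have W: "c @ u \<in> W" using assms(2) c Q_W by simp
  then have "M (rep c) (rep u) (rep (c @ u))" by (rule M_append)
  then show ?thesis using assms c rep_id by auto
qed

lemma M_W: "M u v w \<Longrightarrow> u @ v \<in> W" "M u v w \<Longrightarrow> u \<in> Q" "M u v w \<Longrightarrow> v \<in> Q" "M u v w \<Longrightarrow> w \<in> Q"
  using M_closed[of u v w] unfolding M_def by blast+

text \<open>Prefixes of one word are comparable, so incomparable left divisors of \<open>w\<close>
  must begin two different words for \<open>w\<close>, that is, the two sides of a relation.\<close>

lemma left_divisors: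
  assumes "M u a w" "M u' b w" "\<not> prefix u u'" "\<not> prefix u' u"
  shows "\<exists>r'. (w, r') \<in> set R \<and> {hd u, hd u'} = {hd w, hd r'} \<and> u \<noteq> [] \<and> u' \<noteq> []"
proof -
  have ne: "u \<noteq> []" "u' \<noteq> []" using assms(3,4) by auto
  have w: "w = rep (u @ a)" "w = rep (u' @ b)" using assms(1,2) by (auto simp: M_def)
  have "u @ a \<noteq> u' @ b" using assms(3,4) prefix_same_cases[of u "u @ a" u'] by auto
  moreover have "rep (u @ a) = rep (u' @ b)" using w by metis
  ultimately consider "(u @ a, u' @ b) \<in> set R" | "(u' @ b, u @ a) \<in> set R"
    using rep_eqD by blast
  then show ?thesis
  proof cases
    case 1
    then have "w = u @ a" using w(1) rep_fst by metis
    then show ?thesis using 1 ne by (intro exI[of _ "u' @ b"]) auto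
  next
    case 2
    then have "w = u' @ b" using w(2) rep_fst by metis
    then show ?thesis using 2 ne by (intro exI[of _ "u @ a"]) auto
  qed
qed

lemma right_divisors:
  assumes "M a v w" "M b v' w" "\<not> suffix v v'" "\<not> suffix v' v"
  shows "\<exists>r'. (w, r') \<in> set R \<and> {last v, last v'} = {last w, last r'} \<and> v \<noteq> [] \<and> v' \<noteq> []"
proof -
  have ne: "v \<noteq> []" "v' \<noteq> []" using assms(3,4) by auto
  have w: "w = rep (a @ v)" "w = rep (b @ v')" using assms(1,2) by (auto simp: M_def)
  have "a @ v \<noteq> b @ v'" using assms(3,4) suffix_same_cases[of v "a @ v" v'] by (auto simp: suffix_def)
  moreover have "rep (a @ v) = rep (b @ v')" using w by metis
  ultimately consider "(a @ v, b @ v') \<in> set R" | "(b @ v', a @ v) \<in> set R"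
    using rep_eqD by blast
  then show ?thesis
  proof cases
    case 1
    then have "w = a @ v" using w(1) rep_fst by metis
    then show ?thesis using 1 ne by (intro exI[of _ "b @ v'"]) auto
  next
    case 2
    then have "w = b @ v'" using w(2) rep_fst by metis
    then show ?thesis using 2 ne by (intro exI[of _ "a @ v"]) auto
  qed
qed

lemma first_unique:
  assumes "(r, r') \<in> set R" "(q, q') \<in> set R" "{hd r, hd r'} = {hd q, hd q'}"
  shows "r = q"
proof -
  obtain i j where i: "i < length R" "r = side i True" "r' = side i False"
    and j: "j < length R" "q = side j True" "q' = side j False"
    using assms(1,2) unfolding relation_side by blast
  have "hd r \<in> S" "hd r' \<in> S" "hd r \<noteq> hd r'"
    using side_nth_S[OF i(1), of 0] side_nonempty[OF i(1)] hd_neq[OF assms(1)] i by (auto simp: hd_conv_nth)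
  then have "\<exists>\<^sub>\<le>\<^sub>1 k. k < length R \<and> {hd (fst (R ! k)), hd (snd (R ! k))} = {hd r, hd r'}"
    by (rule first_letters)
  moreover have "{hd (fst (R ! i)), hd (snd (R ! i))} = {hd r, hd r'}"
    using i(2,3) by (simp only: side_def if_True if_False)
  moreover have "{hd (fst (R ! j)), hd (snd (R ! j))} = {hd r, hd r'}"
    unfolding assms(3) using j(2,3) by (simp only: side_def if_True if_False)
  ultimately have "i = j" using i(1) j(1) unfolding Uniq_def by blast
  then show ?thesis using i(2) j(2) by simp
qed

lemma last_unique:
  assumes "(r, r') \<in> set R" "(q, q') \<in> set R" "{last r, last r'} = {last q, last q'}"
  shows "r = q"
proof -
  obtain i j where i: "i < length R" "r = side i True" "r' = side i False"
    and j: "j < length R" "q = side j True" "q' = side j False"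
    using assms(1,2) unfolding relation_side by blast
  have "last r \<in> S" "last r' \<in> S" "last r \<noteq> last r'"
    using last_in_set[OF side_nonempty[OF i(1)]] relators_lists[OF side_relators[OF i(1)]]
      last_neq[OF assms(1)] i by (auto simp: in_lists_conv_set)
  then have "\<exists>\<^sub>\<le>\<^sub>1 k. k < length R \<and> {last (fst (R ! k)), last (snd (R ! k))} = {last r, last r'}"
    by (rule last_letters)
  moreover have "{last (fst (R ! i)), last (snd (R ! i))} = {last r, last r'}"
    using i(2,3) by (simp only: side_def if_True if_False)
  moreover have "{last (fst (R ! j)), last (snd (R ! j))} = {last r, last r'}"
    unfolding assms(3) using j(2,3) by (simp only: side_def if_True if_False)
  ultimately have "i = j" using i(1) j(1) unfolding Uniq_def by blast
  then show ?thesis using i(2) j(2) by simp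
qed

text \<open>The order \<open>leq\<close> of the germ, stated separately because the germ is
  available only after its bowtie axiom has been proved.\<close>

definition dvd_germ :: "'a list doubled \<Rightarrow> 'a list doubled \<Rightarrow> bool" where
  "dvd_germ x z \<longleftrightarrow> (\<exists>y. doubled_mult M x y z)"

lemma dvd_germ_simps:
  "dvd_germ (Pos u) (Pos w) \<longleftrightarrow> (\<exists>v. M u v w)"
  "dvd_germ (Pos u) (Cpl v) \<longleftrightarrow> (\<exists>w. M v u w)"
  "dvd_germ (Cpl v) (Cpl w) \<longleftrightarrow> (\<exists>u. M u w v)"
  "\<not> dvd_germ (Cpl v) (Pos w)"
  by (simp_all add: dvd_germ_def ex_doubled)

lemma dvd_germ_refl:
  assumes "dvd_germ x y"
  shows "dvd_germ x x" "dvd_germ y y"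
  using assms M_W(2-4) M_Nil by (cases x; cases y; simp add: dvd_germ_simps; blast)+

text \<open>\<open>u\<close> and \<open>u'\<close> begin the two sides of a relation, and both may
  follow \<open>v\<close>; a nonempty \<open>v\<close> would give a triangle. So \<open>v\<close> is
  empty and \<open>Cpl v\<close> is the greatest element.\<close>

lemma triangle_Pos_Cpl:
  assumes "\<not> prefix u u'" "\<not> prefix u' u"
    and "dvd_germ (Pos u) (Pos w)" "dvd_germ (Pos u') (Pos w)"
    and "dvd_germ (Pos u) (Cpl v)" "dvd_germ (Pos u') (Cpl v)"
  shows "dvd_germ (Pos w) (Cpl v)"
proof -
  obtain a b where ab: "M u a w" "M u' b w" using assms(3,4) unfolding dvd_germ_simps by blast
  obtain r' where r': "(w, r') \<in> set R" "{hd u, hd u'} = {hd w, hd r'}" "u \<noteq> []" "u' \<noteq> []"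
    using left_divisors[OF ab assms(1,2)] by blast
  have "v @ u \<in> W" "v @ u' \<in> W" using assms(5,6) M_W(1) unfolding dvd_germ_simps by blast+
  then have "v = []" using no_triangle_first[OF r'(1) _ r'(3,4) _ _ r'(2)] by blast
  then show ?thesis using M_Nil(1)[OF M_W(4)[OF ab(1)]] unfolding dvd_germ_simps by blast
qed

text \<open>The mirror image: \<open>u\<close> must be empty, so \<open>Pos u\<close> is the least
  element.\<close>

lemma triangle_Cpl_Pos:
  assumes "\<not> suffix v v'" "\<not> suffix v' v"
    and "dvd_germ (Cpl c) (Cpl v)" "dvd_germ (Cpl c) (Cpl v')"
    and "dvd_germ (Pos u) (Cpl v)" "dvd_germ (Pos u) (Cpl v')"
  shows "dvd_germ (Pos u) (Cpl c)"
proof -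
  obtain a b where ab: "M a v c" "M b v' c" using assms(3,4) unfolding dvd_germ_simps by blast
  obtain r' where r': "(c, r') \<in> set R" "{last v, last v'} = {last c, last r'}" "v \<noteq> []" "v' \<noteq> []"
    using right_divisors[OF ab assms(1,2)] by blast
  have "v @ u \<in> W" "v' @ u \<in> W" using assms(5,6) M_W(1) unfolding dvd_germ_simps by blast+
  then have "u = []" using no_triangle_last[OF r'(1) r'(3,4) _ _ _ r'(2)] by blast
  then show ?thesis using M_Nil(2)[OF M_W(4)[OF ab(1)]] unfolding dvd_germ_simps by blast
qed

text \<open>More than interpolation holds: two of the four elements on one level are comparable. The
  cases by type: all \<open>Pos\<close>, uniqueness of first letters; all \<open>Cpl\<close>,
  uniqueness of last letters; \<open>Pos\<close> below \<open>Cpl\<close>, no squares; one level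
  mixed, no triangles.\<close>

lemma dvd_germ_bowtie:
  assumes px: "dvd_germ p x" and qx: "dvd_germ q x" and py: "dvd_germ p y" and qy: "dvd_germ q y"
  shows "dvd_germ p q \<or> dvd_germ q p \<or> dvd_germ x y \<or> dvd_germ y x"
proof (rule ccontr)
  assume neg: "\<not> ?thesis"
  then have neq: "p \<noteq> q" "x \<noteq> y" using px qx dvd_germ_refl by blast+
  have pre: "\<not> prefix u u'" if "dvd_germ (Pos u) z" "dvd_germ (Pos u') z" "\<not> dvd_germ (Pos u) (Pos u')" for u u' z
  proof -
    have "u \<in> Q" "u' \<in> Q" using dvd_germ_refl(1)[OF that(1)] dvd_germ_refl(1)[OF that(2)] M_W(2)
      unfolding dvd_germ_simps by blast+
    then show ?thesis using prefix_M that(3) unfolding dvd_germ_simps by blast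
  qed
  have suf: "\<not> suffix v v'" if "dvd_germ z (Cpl v)" "dvd_germ z (Cpl v')" "\<not> dvd_germ (Cpl v') (Cpl v)" for v v' z
  proof -
    have "v \<in> Q" "v' \<in> Q" using dvd_germ_refl(2)[OF that(1)] dvd_germ_refl(2)[OF that(2)] M_W(3)
      unfolding dvd_germ_simps by blast+
    then show ?thesis using suffix_M that(3) unfolding dvd_germ_simps by blast
  qed
  show False
  proof (cases p)
    case p: (Pos u)
    show False
    proof (cases q)
      case q: (Pos u')
      have inc: "\<not> prefix u u'" "\<not> prefix u' u" using pre px qx neg p q by blast+
      show False
      proof (cases x)
        case x: (Pos w)
        show False
        proof (cases y)
          case y: (Pos w')
          obtain a b a' b' where ab: "M u a w" "M u' b w" "M u a' w'" "M u' b' w'"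
            using px qx py qy unfolding p q x y dvd_germ_simps by blast
          obtain r where r: "(w, r) \<in> set R" "{hd u, hd u'} = {hd w, hd r}"
            using left_divisors[OF ab(1,2) inc] by blast
          obtain r' where r': "(w', r') \<in> set R" "{hd u, hd u'} = {hd w', hd r'}"
            using left_divisors[OF ab(3,4) inc] by blast
          have "w = w'" by (rule first_unique[OF r(1) r'(1)]) (simp only: r(2)[symmetric] r'(2))
          then show False using neq x y by blast
        next
          case y: (Cpl v)
          then show False using triangle_Pos_Cpl[OF inc] px qx py qy neg p q x by blast
        qed
      next
        case x: (Cpl v)
        show False
        proof (cases y)
          case y: (Pos w)
          then show False using triangle_Pos_Cpl[OF inc] px qx py qy neg p q x by blast
        next
          case y: (Cpl v')
          have inc': "\<not> suffix v v'" "\<not> suffix v' v" using suf px py neg x y by blast+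
          have "v @ u \<in> W" "v @ u' \<in> W" "v' @ u \<in> W" "v' @ u' \<in> W"
            using px qx py qy M_W(1) unfolding p q x y dvd_germ_simps by blast+
          moreover have "v \<noteq> []" "v' \<noteq> []" "u \<noteq> []" "u' \<noteq> []" using inc inc' by auto
          ultimately show False using no_square_W inc inc' by blast
        qed
      qed
    next
      case q: (Cpl c)
      obtain v where x: "x = Cpl v" using qx q dvd_germ_simps(4) by (cases x) auto
      obtain v' where y: "y = Cpl v'" using qy q dvd_germ_simps(4) by (cases y) auto
      have inc': "\<not> suffix v v'" "\<not> suffix v' v" using suf px py neg x y by blast+
      show False using triangle_Cpl_Pos[OF inc'] px qx py qy neg p q x y by blast
    qed
  next
    case p: (Cpl c)
    obtain v where x: "x = Cpl v" using px p dvd_germ_simps(4) by (cases x) auto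
    obtain v' where y: "y = Cpl v'" using py p dvd_germ_simps(4) by (cases y) auto
    have inc': "\<not> suffix v v'" "\<not> suffix v' v" using suf px py neg x y by blast+
    show False
    proof (cases q)
      case q: (Pos u)
      show False using triangle_Cpl_Pos[OF inc'] px qx py qy neg p q x y by blast
    next
      case q: (Cpl c')
      obtain a b a' b' where ab: "M a v c" "M b v' c" "M a' v c'" "M b' v' c'"
        using px qx py qy unfolding p q x y dvd_germ_simps by blast
      obtain r where r: "(c, r) \<in> set R" "{last v, last v'} = {last c, last r}"
        using right_divisors[OF ab(1,2) inc'] by blast
      obtain r' where r': "(c', r') \<in> set R" "{last v, last v'} = {last c', last r'}"
        using right_divisors[OF ab(3,4) inc'] by blast
      have "c = c'" by (rule last_unique[OF r(1) r'(1)]) (simp only: r(2)[symmetric] r'(2))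
      then show False using neq p q by blast
    qed
  qed
qed

sublocale germ "Pos ` Q \<union> Cpl ` Q" "doubled_mult M" "Pos []" "Cpl []"
proof (rule germ_doubled)
  fix p a x q b a' y b'
  assume "doubled_mult M p a x" "doubled_mult M q b x" "doubled_mult M p a' y" "doubled_mult M q b' y"
  then have *: "dvd_germ p x" "dvd_germ q x" "dvd_germ p y" "dvd_germ q y"
    unfolding dvd_germ_def by blast+
  from dvd_germ_bowtie[OF this] have "\<exists>t. dvd_germ p t \<and> dvd_germ q t \<and> dvd_germ t x \<and> dvd_germ t y"
    using * dvd_germ_refl by blast
  then show "\<exists>t. (\<exists>c. doubled_mult M p c t) \<and> (\<exists>c. doubled_mult M q c t) \<and>
      (\<exists>c. doubled_mult M t c x) \<and> (\<exists>c. doubled_mult M t c y)"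
    unfolding dvd_germ_def .
qed

end

section \<open>Invariance of normal forms under the relations\<close>

primrec inverse_letters :: "'a letter list \<Rightarrow> nat" where
  "inverse_letters [] = 0"
| "inverse_letters (x # w) = (case x of Gen _ \<Rightarrow> 0 | Inv _ \<Rightarrow> 1) + inverse_letters w"

lemma inverse_letters_append [simp]:
  "inverse_letters (v @ w) = inverse_letters v + inverse_letters w"
  by (induction v) auto

lemma inverse_letters_Gen [simp]: "inverse_letters (map Gen w) = 0"
  by (induction w) auto

lemma inverse_letters_inverse_word: "inverse_letters (inverse_word (map Gen w)) = length w"
  by (induction w) (auto simp: inverse_word_def)

lemma concat_letters_group_words:
  "(\<And>x. x \<in> set xs \<Longrightarrow> f x \<in> group_words S) \<Longrightarrow> concat (map f xs) \<in> group_words S"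
  by (induction xs) auto

context t5_presentation
begin

abbreviation X :: "'a list doubled set" where
  "X \<equiv> Pos ` Q \<union> Cpl ` Q"

abbreviation shift :: "nat \<Rightarrow> (nat \<Rightarrow> 'a list doubled) \<Rightarrow> nat \<Rightarrow> 'a list doubled" where
  "shift n \<equiv> act (Cpl []) ^^ n"

text \<open>\<open>rep\<close> is needed even for single letters, since a one-letter word may be the
  second side of a relation.\<close>

fun letter_act :: "'a letter \<Rightarrow> (nat \<Rightarrow> 'a list doubled) \<Rightarrow> nat \<Rightarrow> 'a list doubled" where
  "letter_act (Gen s) = act (Pos (rep [s]))"
| "letter_act (Inv s) = act (Cpl (rep [s]))"

definition word_act :: "'a letter list \<Rightarrow> (nat \<Rightarrow> 'a list doubled) \<Rightarrow> nat \<Rightarrow> 'a list doubled" where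
  "word_act w f = foldr letter_act w f"

lemma word_act_simps [simp]:
  "word_act [] f = f"
  "word_act (x # w) f = letter_act x (word_act w f)"
  "word_act (v @ w) f = word_act v (word_act w f)"
  by (simp_all add: word_act_def)

lemma rep_letter: "s \<in> S \<Longrightarrow> rep [s] \<in> Q"
  by (rule rep_Q) (simp add: W_def)

lemma normal_letter_act:
  "x \<in> Gen ` S \<union> Inv ` S \<Longrightarrow> normal f \<Longrightarrow> normal (letter_act x f)"
  using rep_letter by (auto intro!: normal_act)

lemma normal_word_act: "w \<in> group_words S \<Longrightarrow> normal f \<Longrightarrow> normal (word_act w f)"
  by (induction w) (simp_all add: normal_letter_act)

lemma normal_shift: "normal f \<Longrightarrow> normal (shift n f)"
  using normal_act[OF d_in] by (induction n) simp_all

lemma act_shift: "x \<in> X \<Longrightarrow> normal f \<Longrightarrow> act x (shift n f) = shift n (act x f)"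
  by (induction n) (simp_all add: act_d_commute normal_shift)

lemma letter_act_shift:
  "x \<in> Gen ` S \<union> Inv ` S \<Longrightarrow> normal f \<Longrightarrow> letter_act x (shift n f) = shift n (letter_act x f)"
  using rep_letter by (auto simp: act_shift)

lemma word_act_shift:
  "w \<in> group_words S \<Longrightarrow> normal f \<Longrightarrow> word_act w (shift n f) = shift n (word_act w f)"
  by (induction w) (simp_all add: letter_act_shift normal_word_act)

lemma shift_add: "shift n (shift m f) = shift (n + m) f"
  by (simp add: funpow_add)

lemma shift_inj: "normal f \<Longrightarrow> normal g \<Longrightarrow> shift n f = shift n g \<Longrightarrow> f = g"
proof (induction n)
  case (Suc n)
  have "act (Cpl []) (shift n f) = act (Cpl []) (shift n g)" using Suc.prems(3) by simp
  then have "shift n f = shift n g" using act_d_inj normal_shift Suc.prems(1,2) by blast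
  then show ?case using Suc.IH Suc.prems(1,2) by blast
qed simp

lemma word_act_Gen: "u \<in> W \<Longrightarrow> normal f \<Longrightarrow> word_act (map Gen u) f = act (Pos (rep u)) f"
proof (induction u)
  case Nil
  then show ?case using act_e rep_id[OF Nil_Q] by (simp add: normal_def)
next
  case (Cons s u)
  have su: "[s] @ u \<in> W" using Cons.prems(1) by simp
  have "u \<in> W" using W_append[OF su] by blast
  then have "word_act (map Gen u) f = act (Pos (rep u)) f" using Cons by blast
  moreover have "doubled_mult M (Pos (rep [s])) (Pos (rep u)) (Pos (rep (s # u)))"
    using M_append[OF su] by simp
  ultimately show ?case using act_mult Cons.prems(2) by (simp add: normal_def)
qed

lemma act_Pos_Cpl: "u \<in> Q \<Longrightarrow> normal f \<Longrightarrow> act (Pos u) (act (Cpl u) f) = shift 1 f"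
  using act_mult[of "Pos u" "Cpl u" "Cpl []" f] M_Nil by (simp add: normal_def)

lemma act_Cpl_Pos: "u \<in> Q \<Longrightarrow> normal f \<Longrightarrow> act (Cpl u) (act (Pos u) f) = shift 1 f"
  using act_mult[of "Cpl u" "Pos u" "Cpl []" f] M_Nil by (simp add: normal_def)

lemma letter_act_flip:
  "x \<in> Gen ` S \<union> Inv ` S \<Longrightarrow> normal f \<Longrightarrow> letter_act x (letter_act (flip x) f) = shift 1 f"
  using rep_letter act_Pos_Cpl act_Cpl_Pos by (cases x) auto

text \<open>The element of the group represented by \<open>w\<close> corresponds to \<open>\<Delta>\<^sup>-\<^sup>n\<close> times the normal form
  \<open>word_act w unit_seq\<close>, where \<open>n\<close> is the number of inverse letters: cross-multiplying the powers
  of \<open>\<Delta>\<close> avoids constructing the group action.\<close>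

lemma word_act_cong:
  "(v, w) \<in> pres_cong S R \<Longrightarrow> normal f \<Longrightarrow>
    shift (inverse_letters w) (word_act v f) = shift (inverse_letters v) (word_act w f)"
proof (induction rule: pres_cong.induct)
  case (trans u v w)
  have gw: "u \<in> group_words S" "v \<in> group_words S" "w \<in> group_words S"
    using trans.hyps pres_cong_subset[OF R_lists] by auto
  let ?u = "inverse_letters u" and ?v = "inverse_letters v" and ?w = "inverse_letters w"
  \<comment> \<open>The surplus of the middle word \<open>v\<close> enters both sides as a common
    shift and is cancelled at the end by \<open>shift_inj\<close>.\<close>
  have "shift ?v (shift ?w (word_act u f)) = shift ?w (shift ?v (word_act u f))"
    by (simp add: shift_add add.commute)
  also have "\<dots> = shift ?w (shift ?u (word_act v f))" using trans by simp
  also have "\<dots> = shift ?u (shift ?w (word_act v f))" by (simp add: shift_add add.commute)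
  also have "\<dots> = shift ?u (shift ?v (word_act w f))" using trans by simp
  also have "\<dots> = shift ?v (shift ?u (word_act w f))" by (simp add: shift_add add.commute)
  finally show ?case
    by (rule shift_inj[rotated 2]) (use gw trans.prems normal_shift normal_word_act in blast)+
next
  case (cancel x u v)
  have "normal (word_act v f)" using normal_word_act cancel by blast
  then have 1: "word_act (u @ [x, flip x] @ v) f = shift 1 (word_act (u @ v) f)"
    using letter_act_flip[OF cancel(1)] word_act_shift[OF cancel(2), of "word_act v f" 1] by simp
  have 2: "inverse_letters (u @ [x, flip x] @ v) = inverse_letters (u @ v) + 1"
    by (cases x) auto
  show ?case unfolding 1 2 shift_add ..
next
  case (rel r r' u v)
  then have W: "r \<in> W" "r' \<in> W" using relation_relators relators_W by blast+
  have "normal (word_act v f)" using normal_word_act rel by blast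
  then show ?case using word_act_Gen W rep_fst[OF rel(1)] rep_snd[OF rel(1)] by simp
qed simp_all

section \<open>Comparing words with germ elements\<close>

fun letters :: "'a list doubled \<Rightarrow> 'a letter list" where
  "letters (Pos u) = map Gen u"
| "letters (Cpl u) = inverse_word (map Gen u)"

fun level :: "'a list doubled \<Rightarrow> nat" where
  "level (Pos u) = 0"
| "level (Cpl u) = 1"

lemma Gen_group_words: "u \<in> Q \<Longrightarrow> map Gen u \<in> group_words S"
  by (rule map_Gen_in_group_words[OF W_lists[OF Q_W]])

lemma letters_group_words: "x \<in> X \<Longrightarrow> letters x \<in> group_words S"
proof -
  assume "x \<in> X"
  then obtain u where u: "u \<in> Q" "x = Pos u \<or> x = Cpl u" by blast
  then show ?thesis
    using Gen_group_words[OF u(1)] inverse_word_in_group_words[OF Gen_group_words[OF u(1)]] by auto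
qed

text \<open>Two counts of \<open>\<Delta>\<close> are balanced: \<open>level x\<close> is the number
  belonging to the element \<open>x\<close>, and \<open>inverse_letters\<close> is the surplus
  produced when its word acts letter by letter.\<close>

lemma word_act_letters:
  assumes "x \<in> X" "normal f"
  shows "shift (level x) (word_act (letters x) f) = shift (inverse_letters (letters x)) (act x f)"
proof (cases x)
  case (Pos u)
  then have "u \<in> Q" using assms(1) by auto
  then show ?thesis using Pos word_act_Gen[OF Q_W[of u] assms(2)] rep_id[of u] by simp
next
  case (Cpl u)
  then have "u \<in> Q" using assms(1) by auto
  note u = this Gen_group_words[OF this]
  let ?g = "act (Cpl u) f" and ?v = "inverse_word (map Gen u)"
  have g: "normal ?g" "normal (act (Pos u) ?g)"
    using u(1) by (auto intro!: normal_act assms(2))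
  \<comment> \<open>Letting the trivial word \<open>u^-1 u\<close> act on
    \<open>act (Cpl u) f\<close> determines the action of \<open>u^-1\<close>, because
    \<open>u\<close> turns that sequence into the shift of \<open>f\<close>.\<close>
  have "(?v @ map Gen u, []) \<in> pres_cong S R" by (rule pres_cong_inverse_word[OF u(2)])
  from word_act_cong[OF this g(1)]
  have "word_act ?v (word_act (map Gen u) ?g) = shift (length u) ?g"
    by (simp add: inverse_letters_inverse_word)
  moreover have "word_act (map Gen u) ?g = shift 1 f"
    using word_act_Gen[OF Q_W[OF u(1)] g(1)] rep_id[OF u(1)] act_Pos_Cpl[OF u(1) assms(2)] by simp
  moreover have "word_act ?v (shift 1 f) = shift 1 (word_act ?v f)"
    by (rule word_act_shift[OF inverse_word_in_group_words[OF u(2)] assms(2)])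
  ultimately show ?thesis using Cpl by (simp add: inverse_letters_inverse_word)
qed

lemma word_act_concat_letters:
  assumes "xs \<in> lists X"
  shows "shift (sum_list (map level xs)) (word_act (concat (map letters xs)) unit_seq) =
    shift (inverse_letters (concat (map letters xs))) (nf xs)"
  using assms
proof (induction xs rule: list.induct)
  case (Cons x xs)
  then have x: "x \<in> X" "xs \<in> lists X" by auto
  let ?w = "concat (map letters xs)"
  let ?l = "sum_list (map level xs)" and ?n = "inverse_letters ?w"
  have w: "?w \<in> group_words S"
    by (rule concat_letters_group_words) (use x letters_group_words in blast)
  have nw: "normal (word_act ?w unit_seq)" using normal_word_act[OF w normal_unit_seq] .
  have nn: "normal (nf xs)" using normal_nf[OF x(2)] .
  have "shift (level x + ?l) (word_act (letters x) (word_act ?w unit_seq))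
      = shift (level x) (word_act (letters x) (shift ?l (word_act ?w unit_seq)))"
    using word_act_shift[OF letters_group_words[OF x(1)] nw] by (simp add: shift_add)
  also have "\<dots> = shift (level x) (word_act (letters x) (shift ?n (nf xs)))"
    using Cons.IH[OF x(2)] by simp
  also have "\<dots> = shift (inverse_letters (letters x)) (act x (shift ?n (nf xs)))"
    by (rule word_act_letters[OF x(1) normal_shift[OF nn]])
  also have "\<dots> = shift (inverse_letters (letters x) + ?n) (act x (nf xs))"
    using act_shift[OF x(1) nn] by (simp add: shift_add)
  finally show ?case by simp
qed simp

text \<open>The two hypotheses are equality of the products in the two factors of
  \<open>G \<times> \<int>\<close>. Surplus shifts agree on both sides and cancel.\<close>

lemma nf_faithful:
  assumes xs: "xs \<in> lists X" and ys: "ys \<in> lists X"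
    and cong: "(concat (map letters xs), concat (map letters ys)) \<in> pres_cong S R"
    and lev: "sum_list (map level xs) = sum_list (map level ys)"
  shows "nf xs = nf ys"
proof -
  let ?v = "concat (map letters xs)" and ?w = "concat (map letters ys)"
  let ?l = "sum_list (map level xs)"
  let ?i = "inverse_letters ?v" and ?j = "inverse_letters ?w"
  have "shift (?j + ?i) (nf xs) = shift ?l (shift ?j (word_act ?v unit_seq))"
    using word_act_concat_letters[OF xs] by (metis shift_add add.commute)
  also have "\<dots> = shift ?l (shift ?i (word_act ?w unit_seq))"
    using word_act_cong[OF cong normal_unit_seq] by simp
  also have "\<dots> = shift (?j + ?i) (nf ys)"
    using word_act_concat_letters[OF ys] lev by (metis shift_add add.commute)
  finally show ?thesis by (rule shift_inj[rotated 2]) (use normal_nf xs ys in blast)+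
qed

lemma rep_cong:
  assumes "w \<in> W"
  shows "(map Gen (rep w), map Gen w) \<in> pres_cong S R"
proof (rule rep_cases[of w])
  assume "rep w = w"
  then show ?thesis using assms W_lists map_Gen_in_group_words pres_cong.refl by metis
next
  fix r assume r: "(r, w) \<in> set R" "rep w = r"
  then show ?thesis using pres_cong.rel[OF r(1), of "[]" S "[]"] by simp
qed

end

section \<open>The embedding into the product with the integers\<close>

locale t5_group = t5_presentation S R + group G
  for S :: "'a set" and R and G (structure) +
  fixes \<psi> :: "'a letter list set \<Rightarrow> 'g"
  assumes iso: "\<psi> \<in> iso (presented_group S R) G"
begin

definition \<phi> :: "'a letter list \<Rightarrow> 'g" where
  "\<phi> w = \<psi> (pres_cong S R `` {w})"

definition emb :: "'a list doubled \<Rightarrow> 'g \<times> int" where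
  "emb x = (\<phi> (letters x), int (level x))"

lemma class_in_carrier: "w \<in> group_words S \<Longrightarrow> pres_cong S R `` {w} \<in> carrier (presented_group S R)"
  by (simp add: presented_group_def quotientI)

lemma \<phi>_closed: "w \<in> group_words S \<Longrightarrow> \<phi> w \<in> carrier G"
  using iso class_in_carrier unfolding \<phi>_def iso_def hom_def by blast

lemma \<phi>_append:
  assumes "v \<in> group_words S" "w \<in> group_words S"
  shows "\<phi> (v @ w) = \<phi> v \<otimes> \<phi> w"
proof -
  have "\<psi> (pres_cong S R `` {v} \<otimes>\<^bsub>presented_group S R\<^esub> pres_cong S R `` {w}) = \<phi> v \<otimes> \<phi> w"
    using iso class_in_carrier assms unfolding \<phi>_def iso_def hom_def by blast
  then show ?thesis by (simp add: \<phi>_def presented_group_mult_class[OF R_lists assms])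
qed

lemma \<phi>_eq_iff:
  assumes "v \<in> group_words S" "w \<in> group_words S"
  shows "\<phi> v = \<phi> w \<longleftrightarrow> (v, w) \<in> pres_cong S R"
proof -
  have "inj_on \<psi> (carrier (presented_group S R))" using iso by (simp add: iso_def bij_betw_def)
  then have "\<phi> v = \<phi> w \<longleftrightarrow> pres_cong S R `` {v} = pres_cong S R `` {w}"
    unfolding \<phi>_def by (rule inj_on_eq_iff) (rule class_in_carrier assms)+
  also have "\<dots> \<longleftrightarrow> (v, w) \<in> pres_cong S R"
    using eq_equiv_class_iff[OF equiv_pres_cong[OF R_lists] assms] .
  finally show ?thesis .
qed

lemma \<phi>_surj: "g \<in> carrier G \<Longrightarrow> \<exists>w\<in>group_words S. g = \<phi> w"
proof -
  assume "g \<in> carrier G"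
  moreover have "\<psi> ` carrier (presented_group S R) = carrier G"
    using iso by (simp add: iso_def bij_betw_def)
  ultimately obtain c where "c \<in> carrier (presented_group S R)" "g = \<psi> c" by blast
  then show ?thesis unfolding \<phi>_def by (auto simp: presented_group_def elim: quotientE)
qed

lemma \<phi>_Nil: "\<phi> [] = \<one>"
proof -
  have "\<phi> [] \<otimes> \<phi> [] = \<phi> []" using \<phi>_append[of "[]" "[]"] by simp
  then show ?thesis using \<phi>_closed[of "[]"] by simp
qed

lemma \<phi>_inverse_word:
  assumes "w \<in> group_words S"
  shows "\<phi> (inverse_word w) = inv \<phi> w"
proof -
  have iw: "inverse_word w \<in> group_words S" by (rule inverse_word_in_group_words[OF assms])
  have "\<phi> (inverse_word w @ w) = \<phi> []"
    using \<phi>_eq_iff[of "inverse_word w @ w" "[]"] pres_cong_inverse_word[OF assms] iw assms by simp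
  then have "\<phi> (inverse_word w) \<otimes> \<phi> w = \<one>" using \<phi>_append[OF iw assms] \<phi>_Nil by simp
  then show ?thesis using inv_equality \<phi>_closed[OF iw] \<phi>_closed[OF assms] by metis
qed

lemma \<phi>_rep: "w \<in> W \<Longrightarrow> \<phi> (map Gen (rep w)) = \<phi> (map Gen w)"
  using \<phi>_eq_iff rep_cong Gen_group_words rep_Q map_Gen_in_group_words W_lists by metis

lemma \<phi>_M:
  assumes "M u v w"
  shows "\<phi> (map Gen u) \<otimes> \<phi> (map Gen v) = \<phi> (map Gen w)"
proof -
  have w: "u \<in> Q" "v \<in> Q" "u @ v \<in> W" "w = rep (u @ v)" using assms by (auto simp: M_def)
  show ?thesis unfolding w(4) \<phi>_rep[OF w(3)] map_append
    by (rule \<phi>_append[symmetric]) (rule Gen_group_words w)+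
qed

lemma emb_simps:
  assumes "u \<in> Q"
  shows "emb (Pos u) = (\<phi> (map Gen u), 0)" "emb (Cpl u) = (inv \<phi> (map Gen u), 1)"
  using \<phi>_inverse_word[OF Gen_group_words[OF assms]] by (simp_all add: emb_def)

lemma emb_mult_T:
  assumes "doubled_mult M x y z"
  shows "emb x \<otimes>\<^bsub>G \<times>\<times> integer_group\<^esub> emb y = emb z"
  using assms
proof (cases rule: doubled_mult_cases)
  case (1 u v w)
  then show ?thesis using \<phi>_M[OF 1(4)] emb_simps M_W(2-4)[OF 1(4)] by simp
next
  case (2 u v w)
  have c: "\<phi> (map Gen w) \<in> carrier G" "\<phi> (map Gen u) \<in> carrier G"
    using \<phi>_closed Gen_group_words M_W(2-4)[OF 2(4)] by blast+
  have "\<phi> (map Gen u) \<otimes> inv (\<phi> (map Gen w) \<otimes> \<phi> (map Gen u)) = inv \<phi> (map Gen w)"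
    using c by (simp add: inv_mult_group m_assoc[symmetric])
  then show ?thesis unfolding \<phi>_M[OF 2(4)] using 2 emb_simps M_W(2-4)[OF 2(4)] by simp
next
  case (3 u v w)
  have c: "\<phi> (map Gen w) \<in> carrier G" "\<phi> (map Gen u) \<in> carrier G"
    using \<phi>_closed Gen_group_words M_W(2-4)[OF 3(4)] by blast+
  have "inv (\<phi> (map Gen u) \<otimes> \<phi> (map Gen w)) \<otimes> \<phi> (map Gen u) = inv \<phi> (map Gen w)"
    using c by (simp add: inv_mult_group m_assoc)
  then show ?thesis unfolding \<phi>_M[OF 3(4)] using 3 emb_simps M_W(2-4)[OF 3(4)] by simp
qed

lemma emb_foldr:
  assumes "xs \<in> lists X"
  shows "foldr (\<lambda>x. (\<otimes>\<^bsub>G \<times>\<times> integer_group\<^esub>) (emb x)) xs \<one>\<^bsub>G \<times>\<times> integer_group\<^esub> =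
    (\<phi> (concat (map letters xs)), int (sum_list (map level xs)))"
  using assms
proof (induction xs rule: list.induct)
  case Nil
  then show ?case by (simp add: \<phi>_Nil)
next
  case (Cons x xs)
  then have x: "x \<in> X" "xs \<in> lists X" by auto
  have "concat (map letters xs) \<in> group_words S"
    by (rule concat_letters_group_words) (use x letters_group_words in blast)
  then show ?case using Cons.IH[OF x(2)] \<phi>_append[OF letters_group_words[OF x(1)]] by (simp add: emb_def)
qed

lemma group_product: "group (G \<times>\<times> integer_group)"
  by (rule DirProd_group[OF is_group group_integer_group])

lemma emb_in_carrier: "x \<in> X \<Longrightarrow> emb x \<in> carrier (G \<times>\<times> integer_group)"
  using \<phi>_closed[OF letters_group_words] by (simp add: emb_def)

lemma emb_generates: "generate (G \<times>\<times> integer_group) (emb ` X) = carrier (G \<times>\<times> integer_group)"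
proof -
  let ?H = "G \<times>\<times> integer_group" and ?K = "generate (G \<times>\<times> integer_group) (emb ` X)"
  interpret H: group ?H by (rule group_product)
  have sub: "emb ` X \<subseteq> carrier ?H" using emb_in_carrier by blast
  interpret K: subgroup ?K ?H by (rule H.generate_is_subgroup[OF sub])
  have mult: "(g \<otimes> h, k + l) \<in> ?K" if "(g, k) \<in> ?K" "(h, l) \<in> ?K" for g h k l
    using K.m_closed[OF that] by simp
  have inv: "(inv g, - k) \<in> ?K" if "(g, k) \<in> ?K" for g k
    using K.m_inv_closed[OF that] K.mem_carrier[OF that] inv_DirProd[OF is_group group_integer_group, of g k] by simp
  have nat: "(\<one>, int n) \<in> ?K" for n
  proof (induction n)
    case 0
    show ?case using K.one_closed by simp
  next
    case (Suc n)
    \<comment> \<open>\<open>Cpl []\<close> is the Garside element; with its inverse it generates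
      the integer factor.\<close>
    have "emb (Cpl []) = (\<one>, 1)" using emb_simps(2)[OF Nil_Q] \<phi>_Nil by simp
    then have "(\<one>, 1) \<in> ?K" using generate.incl[of "emb (Cpl [])" "emb ` X"] Nil_Q by force
    from mult[OF Suc this] show ?case by (simp add: add.commute)
  qed
  have int: "(\<one>, k) \<in> ?K" for k
  proof (cases "k \<ge> 0")
    case True
    then show ?thesis using nat[of "nat k"] by simp
  next
    case False
    then show ?thesis using inv[OF nat[of "nat (- k)"]] by simp
  qed
  have gen: "(\<phi> [Gen s], 0) \<in> ?K" if s: "s \<in> S" for s
  proof -
    have "emb (Pos (rep [s])) = (\<phi> (map Gen (rep [s])), 0)" by (rule emb_simps(1)[OF rep_letter[OF s]])
    also have "\<phi> (map Gen (rep [s])) = \<phi> [Gen s]" using \<phi>_rep[of "[s]"] s by (simp add: W_def)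
    finally have "emb (Pos (rep [s])) = (\<phi> [Gen s], 0)" .
    moreover have "emb (Pos (rep [s])) \<in> ?K"
      by (rule generate.incl[OF imageI]) (simp add: rep_letter[OF s])
    ultimately show ?thesis by simp
  qed
  have letter: "(\<phi> [x], 0) \<in> ?K" if x: "x \<in> Gen ` S \<union> Inv ` S" for x
  proof (cases x)
    case (Gen s)
    then show ?thesis using gen x by auto
  next
    case (Inv s)
    then have s: "s \<in> S" using x by auto
    have "\<phi> [Inv s] = inv \<phi> [Gen s]"
      using \<phi>_inverse_word[of "[Gen s]"] s by (simp add: inverse_word_def)
    then show ?thesis using inv[OF gen[OF s]] Inv by simp
  qed
  have word: "(\<phi> w, 0) \<in> ?K" if "w \<in> group_words S" for w
    using that
  proof (induction w)
    case Nil
    show ?case using K.one_closed \<phi>_Nil by simp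
  next
    case (Cons x w)
    then have "\<phi> (x # w) = \<phi> [x] \<otimes> \<phi> w" using \<phi>_append[of "[x]" w] by simp
    then show ?case using mult[OF letter Cons.IH] Cons.prems by simp
  qed
  have "(g, k) \<in> ?K" if g: "g \<in> carrier G" for g k
  proof -
    obtain w where w: "w \<in> group_words S" "g = \<phi> w" using \<phi>_surj[OF g] by blast
    then show ?thesis using mult[OF word[OF w(1)] int[of k]] g by simp
  qed
  then show ?thesis using K.subset by auto
qed

theorem garside_product: "garside_group (G \<times>\<times> integer_group)"
proof -
  interpret H: group "G \<times>\<times> integer_group" by (rule group_product)
  interpret garside: garside_rep X "doubled_mult M" "Pos []" "Cpl []" "G \<times>\<times> integer_group" emb
  proof
    show "emb x \<in> carrier (G \<times>\<times> integer_group)" if "x \<in> X" for x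
      by (rule emb_in_carrier[OF that])
    show "emb x \<otimes>\<^bsub>G \<times>\<times> integer_group\<^esub> emb y = emb z" if "doubled_mult M x y z" for x y z
      by (rule emb_mult_T[OF that])
    show "generate (G \<times>\<times> integer_group) (emb ` X) = carrier (G \<times>\<times> integer_group)"
      by (rule emb_generates)
    fix xs ys
    assume xs: "xs \<in> lists X" and ys: "ys \<in> lists X"
      and eq: "foldr (\<lambda>x. (\<otimes>\<^bsub>G \<times>\<times> integer_group\<^esub>) (emb x)) xs \<one>\<^bsub>G \<times>\<times> integer_group\<^esub> =
        foldr (\<lambda>x. (\<otimes>\<^bsub>G \<times>\<times> integer_group\<^esub>) (emb x)) ys \<one>\<^bsub>G \<times>\<times> integer_group\<^esub>"
    have w: "concat (map letters zs) \<in> group_words S" if "zs \<in> lists X" for zs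
      by (rule concat_letters_group_words) (use that letters_group_words in blast)
    show "nf xs = nf ys"
      using eq nf_faithful[OF xs ys] \<phi>_eq_iff[OF w[OF xs] w[OF ys]]
      unfolding emb_foldr[OF xs] emb_foldr[OF ys] by simp
  qed
  show ?thesis by (rule garside.garside_group_H)
qed

end

theorem theorem3p10:
  fixes G :: "('g, 'm) monoid_scheme"
    and S :: "'a set"
    and R :: "('a list \<times> 'a list) list"
  assumes "group G"
    and "finite S"
    and "set R \<subseteq> lists S \<times> lists S"
    and "G \<cong> presented_group S R"
    and "\<And>r r' p. (r, r') \<in> set R \<Longrightarrow> p \<noteq> [] \<Longrightarrow> \<not> (prefix p r \<and> prefix p r')"
    and "\<And>r r' p. (r, r') \<in> set R \<Longrightarrow> p \<noteq> [] \<Longrightarrow> \<not> (suffix p r \<and> suffix p r')"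
    and "\<And>ws i j. ws = concat (map (\<lambda>(r, r'). [r, r']) R) \<Longrightarrow>
           i < length ws \<Longrightarrow> j < length ws \<Longrightarrow> i \<noteq> j \<Longrightarrow> \<not> sublist (ws ! i) (ws ! j)"
    and "\<And>s t. s \<in> S \<Longrightarrow> t \<in> S \<Longrightarrow> s \<noteq> t \<Longrightarrow>
           \<exists>\<^sub>\<le>\<^sub>1 i. i < length R \<and> {hd (fst (R ! i)), hd (snd (R ! i))} = {s, t}"
    and "\<And>s t. s \<in> S \<Longrightarrow> t \<in> S \<Longrightarrow> s \<noteq> t \<Longrightarrow>
           \<exists>\<^sub>\<le>\<^sub>1 i. i < length R \<and> {last (fst (R ! i)), last (snd (R ! i))} = {s, t}"
    and "girth (presentation_link S R) \<ge> 5"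
  shows "garside_group (G \<times>\<times> integer_group)"
proof -
  have pres: "t5_presentation S R"
    by (rule t5_presentation.intro) (fact assms)+
  have "presented_group S R \<cong> G"
    by (rule group.iso_sym[OF assms(1,4)])
  then obtain \<psi> where iso: "\<psi> \<in> iso (presented_group S R) G" unfolding is_iso_def by blast
  have "t5_group S R G \<psi>"
    by (intro t5_group.intro t5_group_axioms.intro pres assms(1) iso)
  then show ?thesis by (rule t5_group.garside_product)
qed

end
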